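(* Let $q\in\mathrm{SU}(2)$. The exponential map $\exp_q : T^*_q(\mathrm{SU}(2)) \to \mathrm{SU}(2)$ fails to be injective in any neighbourhood of any conjugate covector $\lambda_0 \in \mathrm{Conj}_q(\mathrm{SU}(2))$.
   Context: Let $X_0 = \frac12\begin{pmatrix} i & 0\\ 0& -i\end{pmatrix}$, $X_1 = \frac12\begin{pmatrix} 0 & 1\\ -1& 0\end{pmatrix}$, $X_2 = \frac12\begin{pmatrix} 0 & i\\ i& 0\end{pmatrix}$ be the basis of $\mathfrak{su}(2)$, regarded as left-invariant vector fields on $\mathrm{SU}(2)$. The sub-Riemannian structure on $\mathrm{SU}(2)$ is the left-invariant one with distribution spanned by $X_1,X_2$ and metric making $X_1,X_2$ orthonormal. Its Hamiltonian is $H(q,\lambda)=\frac12(\langle\lambda,X_1(q)\rangle^2+\langle\lambda,X_2(q)\rangle^2)$ on $T^*(\mathrm{SU}(2))$. The exponential map is $\exp_q(\lambda_0)=\pi(e^{\vec H}(q,\lambda_0))$, where $e^{t\vec H}$ is the Hamiltonian flow of $H$ and $\pi:T^*(\mathrm{SU}(2))\to\mathrm{SU}(2)$ is the bundle projection; it is defined on all of $T_q^*(\mathrm{SU}(2))$. The conjugate locus is $\mathrm{Conj}_q(\mathrm{SU}(2))=\{\lambda_0\in T^*_q(\mathrm{SU}(2)) : \mathrm{Ker}(d_{\lambda_0}\exp_q)\neq\{0\}\}$, and its elements are called conjugate covectors. *)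

theory Defs
  imports "HOL-Analysis.Analysis"
begin

text \<open>
  Manifolds are given as embedded submanifolds of a Euclidean space. The tangent space at
  a point is the set of velocities of curves in the manifold through that point.
\<close>

definition tangent_space :: "'a::euclidean_space set \<Rightarrow> 'a \<Rightarrow> 'a set" where
  "tangent_space M x =
     {v. \<exists>c. (\<forall>\<^sub>F t in nhds (0::real). c t \<in> M) \<and> c 0 = x \<and>
             (c has_vector_derivative v) (at 0)}"

text \<open>
  A covector at \<open>q\<close>, i.e. a linear functional on the tangent space, is represented by the
  unique tangent vector \<open>\<lambda>\<close> such that the functional is \<open>v \<mapsto> \<lambda> \<bullet> v\<close>, where \<open>\<bullet>\<close> is the
  inner product of the ambient space; so \<open>\<langle>\<lambda>, v\<rangle>\<close> is \<open>\<lambda> \<bullet> v\<close> for tangent \<open>v\<close>. The lemma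
  shows that this representation is a bijection. The ambient inner product plays no other role.
\<close>

definition cotangent_space :: "'a::euclidean_space set \<Rightarrow> 'a \<Rightarrow> 'a set" where
  "cotangent_space M q = tangent_space M q"

lemma covector_representation:
  fixes T :: "'a::euclidean_space set" and f :: "'a \<Rightarrow> real"
  assumes T: "subspace T"
    and add: "\<And>v w. v \<in> T \<Longrightarrow> w \<in> T \<Longrightarrow> f (v + w) = f v + f w"
    and scale: "\<And>c v. v \<in> T \<Longrightarrow> f (c *\<^sub>R v) = c * f v"
  shows "\<exists>!l. l \<in> T \<and> (\<forall>v\<in>T. f v = l \<bullet> v)"
proof -
  obtain B where B: "B \<subseteq> T" "pairwise orthogonal B" "\<And>x. x \<in> B \<Longrightarrow> norm x = 1"
      "independent B" "card B = dim T" "span B = T"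
    using orthonormal_basis_subspace[OF T] by metis
  have fin: "finite B"
    using B(4) by (rule independent_imp_finite)
  have f0: "f 0 = 0"
    using scale[of 0 0] subspace_0[OF T] by simp
  define l where "l = (\<Sum>b\<in>B. f b *\<^sub>R b)"
  have lT: "l \<in> T"
    unfolding l_def using B(1) T by (intro subspace_sum subspace_scale) auto
  have onB: "l \<bullet> b = f b" if "b \<in> B" for b
  proof -
    have "l \<bullet> b = (\<Sum>a\<in>B. f a * (a \<bullet> b))"
      by (simp add: l_def inner_sum_left)
    also have "\<dots> = (\<Sum>a\<in>B. if a = b then f b else 0)"
    proof (rule sum.cong[OF refl])
      fix a assume "a \<in> B"
      then show "f a * (a \<bullet> b) = (if a = b then f b else 0)"
        using B(2) B(3)[OF that] that
        by (auto simp: pairwise_def orthogonal_def dot_square_norm)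
    qed
    finally show ?thesis
      using fin that by simp
  qed
  have on_span: "v \<in> T \<and> f v = l \<bullet> v" if "v \<in> span B" for v
    using that
  proof (induction rule: span_induct_alt)
    case base
    then show ?case using f0 subspace_0[OF T] by simp
  next
    case (step c x y)
    then have "x \<in> T" using B(1) by auto
    with step show ?case
      using T add[of "c *\<^sub>R x" y] scale[of x c] onB[of x]
      by (auto simp: inner_add_right intro: subspace_add subspace_scale)
  qed
  show ?thesis
  proof (rule ex1I[of _ l])
    show "l \<in> T \<and> (\<forall>v\<in>T. f v = l \<bullet> v)"
      using lT on_span B(6) by auto
  next
    fix m assume m: "m \<in> T \<and> (\<forall>v\<in>T. f v = m \<bullet> v)"
    have d: "m - l \<in> T"
      using m lT T by (auto intro: subspace_diff)
    then have "(m - l) \<bullet> (m - l) = 0"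
      using m on_span[of "m - l"] B(6) by (simp add: inner_diff_left)
    then show "m = l" by simp
  qed
qed

definition cotangent_bundle :: "'a::euclidean_space set \<Rightarrow> ('a \<times> 'a) set" where
  "cotangent_bundle M = Sigma M (cotangent_space M)"

text \<open>
  The form \<open>d\<lambda> \<and> dq\<close> of the ambient space. In the above representation of covectors the
  Liouville form of \<open>T\<^sup>*M\<close> is the restriction of \<open>\<lambda> \<bullet> dq\<close>, hence its exterior derivative,
  the canonical symplectic form of \<open>T\<^sup>*M\<close>, is the restriction of this form.
\<close>

definition symplectic_form :: "'a::euclidean_space \<times> 'a \<Rightarrow> 'a \<times> 'a \<Rightarrow> real" where
  "symplectic_form V W = snd V \<bullet> fst W - snd W \<bullet> fst V"

text \<open>
  The vector field \<open>V = hamiltonian_field M H\<close> on \<open>T\<^sup>*M\<close> is determined by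
  \<open>\<sigma>(W, V) = dH(W)\<close> for all tangent \<open>W\<close>, so that \<open>q' = \<partial>H/\<partial>\<lambda>\<close> and \<open>\<lambda>' = -\<partial>H/\<partial>q\<close> in canonical coordinates.
  The function \<open>H\<close> has to be differentiable on the whole ambient space; on tangent
  vectors its ambient derivative is the differential of its restriction to \<open>T\<^sup>*M\<close>.
\<close>

definition hamiltonian_field ::
    "'a::euclidean_space set \<Rightarrow> ('a \<times> 'a \<Rightarrow> real) \<Rightarrow> 'a \<times> 'a \<Rightarrow> 'a \<times> 'a" where
  "hamiltonian_field M H z =
     (THE V. V \<in> tangent_space (cotangent_bundle M) z \<and>
        (\<forall>W \<in> tangent_space (cotangent_bundle M) z.
           symplectic_form W V = frechet_derivative H (at z) W))"

text \<open>Integral curves are required to exist for all times, i.e. the field should be complete.\<close>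

definition hamiltonian_flow ::
    "'a::euclidean_space set \<Rightarrow> ('a \<times> 'a \<Rightarrow> real) \<Rightarrow> real \<Rightarrow> 'a \<times> 'a \<Rightarrow> 'a \<times> 'a" where
  "hamiltonian_flow M H t z =
     (THE w. \<exists>\<gamma>. (\<forall>s. \<gamma> s \<in> cotangent_bundle M \<and>
                     (\<gamma> has_vector_derivative hamiltonian_field M H (\<gamma> s)) (at s)) \<and>
                \<gamma> 0 = z \<and> \<gamma> t = w)"

definition SU2 :: "(complex^2^2) set" where
  "SU2 = {A. A ** map_matrix cnj (transpose A) = mat 1 \<and> det A = 1}"

definition X1 :: "complex^2^2" where
  "X1 = (1/2) *\<^sub>R vector [vector [0, 1], vector [-1, 0]]"

definition X2 :: "complex^2^2" where
  "X2 = (1/2) *\<^sub>R vector [vector [0, \<i>], vector [\<i>, 0]]"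

definition left_invariant_field :: "complex^2^2 \<Rightarrow> complex^2^2 \<Rightarrow> complex^2^2" where
  "left_invariant_field X q = q ** X"

definition sr_hamiltonian :: "(complex^2^2) \<times> (complex^2^2) \<Rightarrow> real" where
  "sr_hamiltonian = (\<lambda>(q, l).
     1/2 * ((l \<bullet> left_invariant_field X1 q)\<^sup>2 + (l \<bullet> left_invariant_field X2 q)\<^sup>2))"

definition sr_exp :: "complex^2^2 \<Rightarrow> complex^2^2 \<Rightarrow> complex^2^2" where
  "sr_exp q l = fst (hamiltonian_flow SU2 sr_hamiltonian 1 (q, l))"

text \<open>
  The differential of the exponential map at \<open>l\<close> is the restriction of \<open>D\<close> to
  \<open>cotangent_space SU2 q\<close>, on which \<open>D\<close> is uniquely determined.
\<close>

definition conjugate_locus :: "complex^2^2 \<Rightarrow> (complex^2^2) set" where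
  "conjugate_locus q =
     {l \<in> cotangent_space SU2 q.
        \<exists>D. (sr_exp q has_derivative D) (at l within cotangent_space SU2 q) \<and>
            {v \<in> cotangent_space SU2 q. D v = 0} \<noteq> {0}}"

end

theory Submission
  imports Defs
begin

text \<open>
  \<open>SU(2)\<close> is a sphere in the 4-dimensional space of the matrices \<open>quat a b\<close>. On it, the Hamiltonian
  equations are \<open>q' = q P\<close>, \<open>\<lambda>' = \<lambda> P\<close> with \<open>P\<close> the horizontal part of \<open>q\<^sup>-\<^sup>1 \<lambda> / 2\<close>. Both
  \<open>\<lambda> \<bullet> \<lambda>\<close> and the vertical component of \<open>\<lambda>\<close> are constant along solutions, so the equations reduce to a
  linear system with constant coefficients. In coordinates \<open>(a, z) \<in> \<real> \<times> \<complex>\<close> on the covectors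
  at \<open>q\<close>, with \<open>r = sqrt (a\<^sup>2 + |z|\<^sup>2)\<close>, the exponential map becomes \<open>q ** quat u w\<close>, where
  \<open>u = (cos r + \<i> a sin r / r) cis (- a)\<close> and \<open>w = z (sin r / r) cis a\<close>.

  It is singular only if \<open>z = 0\<close>, \<open>sin r = 0\<close> or \<open>sin r = r cos r\<close>. It does not depend on \<open>a\<close> in
  the first case, nor on the argument of \<open>z\<close> in the second. In the third case with \<open>a \<noteq> 0\<close> the map is a
  fold: on a curve transversal to \<open>r = r0\<close> on which \<open>w\<close> is constant, \<open>u\<close> turns back on a circle.
  Points with \<open>a = 0\<close> are limits of such folds.
\<close>

section \<open>Quaternion coordinates\<close>

definition quat :: "complex \<Rightarrow> complex \<Rightarrow> complex^2^2" where
  "quat a b = vector [vector [a, b], vector [- cnj b, cnj a]]"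

text \<open>Real-linear conditions on the entries, instead of the range of \<open>quat\<close>, so
  that subspace properties and membership follow by simplification.\<close>

definition quats :: "(complex^2^2) set" where
  "quats = {A. A $ 2 $ 1 = - cnj (A $ 1 $ 2) \<and> A $ 2 $ 2 = cnj (A $ 1 $ 1)}"

text \<open>The vertical direction. The horizontal part of a velocity is obtained below by
  subtracting its component along this field.\<close>

definition X0 :: "complex^2^2" where
  "X0 = (1/2) *\<^sub>R vector [vector [\<i>, 0], vector [0, - \<i>]]"

lemma mat2_eq_iff:
  fixes A B :: "complex^2^2"
  shows "A = B \<longleftrightarrow> A $ 1 $ 1 = B $ 1 $ 1 \<and> A $ 1 $ 2 = B $ 1 $ 2 \<and>
                   A $ 2 $ 1 = B $ 2 $ 1 \<and> A $ 2 $ 2 = B $ 2 $ 2"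
  by (auto simp: vec_eq_iff forall_2)

lemma inner_mat2:
  fixes A B :: "complex^2^2"
  shows "A \<bullet> B = (A $ 1 $ 1) \<bullet> (B $ 1 $ 1) + (A $ 1 $ 2) \<bullet> (B $ 1 $ 2) +
                 (A $ 2 $ 1) \<bullet> (B $ 2 $ 1) + (A $ 2 $ 2) \<bullet> (B $ 2 $ 2)"
  by (simp add: inner_vec_def sum_2)

lemma mult_mat2:
  fixes A B :: "complex^2^2"
  shows "(A ** B) $ i $ j = A $ i $ 1 * B $ 1 $ j + A $ i $ 2 * B $ 2 $ j"
  by (simp add: matrix_matrix_mult_def sum_2)

lemma quat_nth [simp]:
  "quat a b $ 1 $ 1 = a" "quat a b $ 1 $ 2 = b"
  "quat a b $ 2 $ 1 = - cnj b" "quat a b $ 2 $ 2 = cnj a"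
  by (simp_all add: quat_def)

lemma X_nth [simp]:
  "X0 $ 1 $ 1 = \<i> / 2" "X0 $ 1 $ 2 = 0" "X0 $ 2 $ 1 = 0" "X0 $ 2 $ 2 = - \<i> / 2"
  "X1 $ 1 $ 1 = 0" "X1 $ 1 $ 2 = 1 / 2" "X1 $ 2 $ 1 = - 1 / 2" "X1 $ 2 $ 2 = 0"
  "X2 $ 1 $ 1 = 0" "X2 $ 1 $ 2 = \<i> / 2" "X2 $ 2 $ 1 = \<i> / 2" "X2 $ 2 $ 2 = 0"
  by (simp_all add: X0_def X1_def X2_def complex_eq_iff)

lemma quats_iff: "A \<in> quats \<longleftrightarrow> (\<exists>a b. A = quat a b)"
  by (auto simp: quats_def mat2_eq_iff)

lemma quat_in_quats [simp]: "quat a b \<in> quats"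
  by (simp add: quats_def)

lemma X_in_quats: "X0 \<in> quats" "X1 \<in> quats" "X2 \<in> quats"
  by (simp_all add: quats_def)

lemma subspace_quats: "subspace quats"
  by (auto simp: subspace_def quats_def)

lemma quat_mult: "quat a b ** quat c d = quat (a * c - b * cnj d) (a * d + b * cnj c)"
  by (simp add: mat2_eq_iff mult_mat2 algebra_simps)

lemma quats_mult: "A \<in> quats \<Longrightarrow> B \<in> quats \<Longrightarrow> A ** B \<in> quats"
  unfolding quats_iff using quat_mult by blast

lemma quat_inner: "quat a b \<bullet> quat c d = 2 * (a \<bullet> c + b \<bullet> d)"
  by (simp add: inner_mat2 inner_complex_def algebra_simps)

text \<open>The squared norm is 2 because both entries of the first row recur in the second, up to
  sign and conjugation.\<close>

lemma SU2_eq: "SU2 = {A \<in> quats. A \<bullet> A = 2}"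
proof (intro set_eqI iffI)
  fix A assume "A \<in> SU2"
  then have *: "A $ 1 $ 1 * cnj (A $ 1 $ 1) + A $ 1 $ 2 * cnj (A $ 1 $ 2) = 1"
    "A $ 1 $ 1 * cnj (A $ 2 $ 1) + A $ 1 $ 2 * cnj (A $ 2 $ 2) = 0"
    "A $ 2 $ 1 * cnj (A $ 1 $ 1) + A $ 2 $ 2 * cnj (A $ 1 $ 2) = 0"
    "A $ 2 $ 1 * cnj (A $ 2 $ 1) + A $ 2 $ 2 * cnj (A $ 2 $ 2) = 1"
    "A $ 1 $ 1 * A $ 2 $ 2 - A $ 1 $ 2 * A $ 2 $ 1 = 1"
    unfolding SU2_def mat2_eq_iff mult_mat2 by (auto simp: map_matrix_def transpose_def mat_def det_2)
  have d: "A $ 2 $ 2 = cnj (A $ 1 $ 1)" using *(1,3,5) by algebra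
  have c: "A $ 2 $ 1 = - cnj (A $ 1 $ 2)" using *(1,3,5) by algebra
  have AQ: "A = quat (A $ 1 $ 1) (A $ 1 $ 2)" using c d by (simp add: mat2_eq_iff)
  have "A \<bullet> A = 2 * Re (A $ 1 $ 1 * cnj (A $ 1 $ 1) + A $ 1 $ 2 * cnj (A $ 1 $ 2))"
    by (subst (1 2) AQ, subst quat_inner) (simp add: inner_complex_def)
  then show "A \<in> {A \<in> quats. A \<bullet> A = 2}" using *(1) c d by (auto simp: quats_def)
next
  fix A assume A: "A \<in> {A \<in> quats. A \<bullet> A = 2}"
  then obtain a b where AQ: "A = quat a b" by (auto simp: quats_iff)
  with A have "a \<bullet> a + b \<bullet> b = 1" by (simp add: quat_inner)
  then have n: "a * cnj a + b * cnj b = 1"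
    by (simp add: complex_eq_iff inner_complex_def algebra_simps)
  show "A \<in> SU2"
    unfolding SU2_def mat2_eq_iff mult_mat2 AQ using n
    by (simp add: map_matrix_def transpose_def mat_def det_2 algebra_simps)
qed

text \<open>Each \<open>X\<close> is skew-Hermitian, so right multiplication by it is an
  infinitesimal rotation. All conservation laws below rest on this.\<close>

lemma mult_X_skew:
  fixes A B :: "complex^2^2"
  shows "(A ** X0) \<bullet> B = - (A \<bullet> (B ** X0))" "(A ** X1) \<bullet> B = - (A \<bullet> (B ** X1))"
    "(A ** X2) \<bullet> B = - (A \<bullet> (B ** X2))"
  by (simp_all add: inner_mat2 mult_mat2 inner_complex_def algebra_simps)

lemma mult_X_self:
  fixes A :: "complex^2^2"
  shows "A \<bullet> (A ** X0) = 0" "A \<bullet> (A ** X1) = 0" "A \<bullet> (A ** X2) = 0"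
  using mult_X_skew[of A A] by (simp_all add: inner_commute)

lemma mult_X0_X0: "(A ** X0) ** X0 = (- 1/4) *\<^sub>R (A :: complex^2^2)"
  by (simp add: mat2_eq_iff mult_mat2 complex_eq_iff)

lemma bounded_linear_matrix_mult_right [bounded_linear]:
  "bounded_linear (\<lambda>A :: complex^2^2. A ** (B :: complex^2^2))"
  by (simp add: linear_conv_bounded_linear[symmetric] linear_iff mat2_eq_iff mult_mat2 algebra_simps)

lemma bounded_linear_matrix_mult_left [bounded_linear]:
  "bounded_linear (\<lambda>A :: complex^2^2. (B :: complex^2^2) ** A)"
  by (simp add: linear_conv_bounded_linear[symmetric] linear_iff mat2_eq_iff mult_mat2 algebra_simps)

lemma mult_right_linear:
  fixes A B C :: "complex^2^2"
  shows "(A + B) ** C = A ** C + B ** C" "(A - B) ** C = A ** C - B ** C" "(k *\<^sub>R A) ** C = k *\<^sub>R (A ** C)"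
  using bounded_linear.linear[OF bounded_linear_matrix_mult_right, of C]
  by (rule linear_add linear_diff linear_scale)+

section \<open>Cotangent bundles of spheres\<close>

lemma has_real_derivative_inner:
  fixes f g :: "real \<Rightarrow> 'a::real_inner"
  assumes f: "(f has_vector_derivative f') (at x)" and g: "(g has_vector_derivative g') (at x)"
  shows "((\<lambda>t. f t \<bullet> g t) has_real_derivative f x \<bullet> g' + f' \<bullet> g x) (at x)"
proof -
  have "(*) (f x \<bullet> g' + f' \<bullet> g x) = (\<lambda>h. f x \<bullet> (h *\<^sub>R g') + (h *\<^sub>R f') \<bullet> g x)"
    by (auto simp: algebra_simps)
  then show ?thesis
    using has_derivative_inner[OF f[unfolded has_vector_derivative_def] g[unfolded has_vector_derivative_def]]
    by (simp only: has_field_derivative_def)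
qed

text \<open>Turns a quadratic constraint on curves into a linear constraint on their
  velocities.\<close>

lemma vector_derivative_inner_zero:
  fixes f g :: "real \<Rightarrow> 'a::real_inner"
  assumes ev: "\<forall>\<^sub>F t in nhds x. f t \<bullet> g t = k"
    and f: "(f has_vector_derivative f') (at x)" and g: "(g has_vector_derivative g') (at x)"
  shows "f x \<bullet> g' + f' \<bullet> g x = 0"
proof (rule DERIV_unique)
  show "((\<lambda>t. f t \<bullet> g t) has_real_derivative f x \<bullet> g' + f' \<bullet> g x) (at x)"
    using f g by (rule has_real_derivative_inner)
  show "((\<lambda>t. f t \<bullet> g t) has_real_derivative 0) (at x)"
    using DERIV_cong_ev[OF refl ev refl, of 0] by simp
qed

text \<open>If \<open>z\<close> is the part of the velocity orthogonal to \<open>S\<close>, then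
  \<open>z \<bullet> f t\<close> vanishes near \<open>x\<close>, and its derivative is
  \<open>z \<bullet> z\<close>.\<close>

lemma vector_derivative_in_subspace:
  fixes f :: "real \<Rightarrow> 'a::euclidean_space"
  assumes S: "subspace S" and ev: "\<forall>\<^sub>F t in nhds x. f t \<in> S"
    and f: "(f has_vector_derivative f') (at x)"
  shows "f' \<in> S"
proof -
  obtain y z where y: "y \<in> span S" and z: "\<And>w. w \<in> span S \<Longrightarrow> orthogonal z w" and f': "f' = y + z"
    using orthogonal_subspace_decomp_exists by blast
  have "\<forall>\<^sub>F t in nhds x. z \<bullet> f t = 0"
    using ev by eventually_elim (use z S in \<open>auto simp: orthogonal_def span_base\<close>)
  from vector_derivative_inner_zero[OF this has_vector_derivative_const f] have "z \<bullet> f' = 0" by simp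
  then have "z \<bullet> z = 0"
    using z[OF y] by (simp add: f' inner_add_right orthogonal_def)
  then show ?thesis using f' y S[folded span_eq_iff] by simp
qed

text \<open>Differentiating the equation of the sphere gives one inclusion. For the other, a
  straight line is projected radially to the sphere.\<close>

lemma sphere_tangent_space:
  fixes S :: "'a::euclidean_space set"
  assumes S: "subspace S" and k: "k > 0"
    and M: "M = {x \<in> S. x \<bullet> x = k}" and q: "q \<in> M"
  shows "tangent_space M q = {v \<in> S. v \<bullet> q = 0}"
proof (intro set_eqI iffI)
  fix v assume "v \<in> tangent_space M q"
  then obtain c where c: "\<forall>\<^sub>F t in nhds 0. c t \<in> M" "c 0 = q" "(c has_vector_derivative v) (at 0)"
    by (auto simp: tangent_space_def)
  have "v \<in> S"
    by (rule vector_derivative_in_subspace[OF S _ c(3)]) (use c(1) M in \<open>auto elim: eventually_mono\<close>)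
  moreover have "c 0 \<bullet> v + v \<bullet> c 0 = 0"
    by (rule vector_derivative_inner_zero[where k = k, OF _ c(3) c(3)]) (use c(1) M in \<open>auto elim: eventually_mono\<close>)
  ultimately show "v \<in> {v \<in> S. v \<bullet> q = 0}" using c(2) by (simp add: inner_commute)
next
  fix v assume v: "v \<in> {v \<in> S. v \<bullet> q = 0}"
  have qq: "q \<in> S" "q \<bullet> q = k" using q M by auto
  \<comment> \<open>Since \<open>v\<close> is orthogonal to \<open>q\<close>, the squared norm of
    \<open>q + t v\<close> is \<open>k + t^2 (v \<bullet> v)\<close>. The factor is stationary at 0,
    hence does not change the velocity.\<close>
  define n where "n t = sqrt (k / (k + t\<^sup>2 * (v \<bullet> v)))" for t
  define c where "c t = n t *\<^sub>R (q + t *\<^sub>R v)" for t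
  have pos: "k + t\<^sup>2 * (v \<bullet> v) > 0" for t using k by (simp add: add_pos_nonneg)
  have n0: "n 0 = 1" using k by (simp add: n_def)
  have "(n has_real_derivative 0) (at 0)"
    unfolding n_def using k by (auto intro!: derivative_eq_intros)
  then have "(c has_vector_derivative v) (at 0)"
    unfolding c_def using n0 by (auto intro!: derivative_eq_intros)
  moreover have "c t \<in> M" for t
  proof -
    have "c t \<bullet> c t = (n t)\<^sup>2 * (k + t\<^sup>2 * (v \<bullet> v))"
      using qq v by (simp add: c_def inner_add_left inner_add_right inner_commute power2_eq_square algebra_simps)
    also have "\<dots> = k" using pos[of t] k by (simp add: n_def)
    finally show ?thesis using qq v S by (simp add: M c_def subspace_scale subspace_add)
  qed
  moreover have "c 0 = q" by (simp add: c_def n0)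
  ultimately show "v \<in> tangent_space M q"
    unfolding tangent_space_def by (intro CollectI exI[of _ c]) simp
qed

lemma sphere_cotangent_bundle:
  fixes S :: "'a::euclidean_space set"
  assumes S: "subspace S" and k: "k > 0"
    and M: "M = {x \<in> S. x \<bullet> x = k}"
  shows "cotangent_bundle M = {(q, l). q \<in> S \<and> l \<in> S \<and> q \<bullet> q = k \<and> l \<bullet> q = 0}"
  using sphere_tangent_space[OF S k M] by (auto simp: cotangent_bundle_def cotangent_space_def M)

text \<open>The last condition is the derivative of \<open>l \<bullet> q = 0\<close>. Conversely, a
  curve with velocity \<open>v\<close> in the sphere is lifted to the bundle.\<close>

lemma sphere_tangent_space_cotangent_bundle:
  fixes S :: "'a::euclidean_space set"
  assumes S: "subspace S" and k: "k > 0"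
    and M: "M = {x \<in> S. x \<bullet> x = k}" and ql: "(q, l) \<in> cotangent_bundle M"
  shows "tangent_space (cotangent_bundle M) (q, l) =
    {(v, w). v \<in> S \<and> w \<in> S \<and> v \<bullet> q = 0 \<and> w \<bullet> q + l \<bullet> v = 0}"
proof (intro set_eqI iffI)
  fix z assume "z \<in> tangent_space (cotangent_bundle M) (q, l)"
  then obtain c where c: "\<forall>\<^sub>F t in nhds 0. c t \<in> cotangent_bundle M" "c 0 = (q, l)"
    "(c has_vector_derivative z) (at 0)"
    by (auto simp: tangent_space_def)
  obtain v w where z: "z = (v, w)" by force
  have 1: "((\<lambda>t. fst (c t)) has_vector_derivative v) (at 0)"
    using bounded_linear.has_vector_derivative[OF bounded_linear_fst c(3)] z by simp
  have 2: "((\<lambda>t. snd (c t)) has_vector_derivative w) (at 0)"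
    using bounded_linear.has_vector_derivative[OF bounded_linear_snd c(3)] z by simp
  note c1 = c(1)[unfolded sphere_cotangent_bundle[OF S k M]]
  have "v \<in> S"
    by (rule vector_derivative_in_subspace[OF S _ 1]) (use c1 in \<open>auto elim!: eventually_mono\<close>)
  moreover have "w \<in> S"
    by (rule vector_derivative_in_subspace[OF S _ 2]) (use c1 in \<open>auto elim!: eventually_mono\<close>)
  moreover have "fst (c 0) \<bullet> v + v \<bullet> fst (c 0) = 0"
    by (rule vector_derivative_inner_zero[where k = k, OF _ 1 1]) (use c1 in \<open>auto elim!: eventually_mono\<close>)
  moreover have "snd (c 0) \<bullet> v + w \<bullet> fst (c 0) = 0"
    by (rule vector_derivative_inner_zero[where k = 0, OF _ 2 1]) (use c1 in \<open>auto elim!: eventually_mono\<close>)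
  ultimately show "z \<in> {(v, w). v \<in> S \<and> w \<in> S \<and> v \<bullet> q = 0 \<and> w \<bullet> q + l \<bullet> v = 0}"
    using c(2) z by (simp add: inner_commute)
next
  fix z assume "z \<in> {(v, w). v \<in> S \<and> w \<in> S \<and> v \<bullet> q = 0 \<and> w \<bullet> q + l \<bullet> v = 0}"
  then obtain v w where z: "z = (v, w)" "v \<in> S" "w \<in> S" "v \<bullet> q = 0" "w \<bullet> q + l \<bullet> v = 0" by auto
  have ql': "q \<in> M" "l \<in> S" "l \<bullet> q = 0" "q \<bullet> q = k"
    using ql unfolding sphere_cotangent_bundle[OF S k M] by (auto simp: M)
  have "v \<in> tangent_space M q" using z sphere_tangent_space[OF S k M ql'(1)] by simp
  then obtain c where c: "\<forall>\<^sub>F t in nhds 0. c t \<in> M" "c 0 = q" "(c has_vector_derivative v) (at 0)"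
    by (auto simp: tangent_space_def)
  \<comment> \<open>Projection of \<open>l + t w\<close> to the complement of \<open>c t\<close>.
    The subtracted coefficient vanishes at 0 together with its derivative
    \<open>w \<bullet> q + l \<bullet> v\<close>, so the velocity stays \<open>w\<close>.\<close>
  define p where "p t = (l + t *\<^sub>R w) - (((l + t *\<^sub>R w) \<bullet> c t) / k) *\<^sub>R c t" for t
  have "((\<lambda>t. l + t *\<^sub>R w) has_vector_derivative w) (at 0)"
    by (auto intro!: derivative_eq_intros)
  from has_real_derivative_inner[OF this c(3)]
  have "((\<lambda>t. (l + t *\<^sub>R w) \<bullet> c t) has_real_derivative 0) (at 0)"
    using c(2) z(5) by (simp add: add.commute)
  then have "(p has_vector_derivative w) (at 0)"
    unfolding p_def using c(2,3) ql'(3) k by (auto intro!: derivative_eq_intros)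
  then have "((\<lambda>t. (c t, p t)) has_vector_derivative z) (at 0)"
    unfolding z using c(3) by (intro has_vector_derivative_Pair)
  moreover have "\<forall>\<^sub>F t in nhds 0. (c t, p t) \<in> cotangent_bundle M"
    using c(1)
  proof eventually_elim
    case (elim t)
    then show ?case
      using S z ql' k unfolding sphere_cotangent_bundle[OF S k M]
      by (auto simp: M p_def inner_diff_left intro!: subspace_diff subspace_add subspace_scale)
  qed
  moreover have "(c 0, p 0) = (q, l)" using c(2) ql' by (simp add: p_def)
  ultimately show "z \<in> tangent_space (cotangent_bundle M) (q, l)"
    unfolding tangent_space_def by (intro CollectI exI[of _ "\<lambda>t. (c t, p t)"]) simp
qed

text \<open>Gives uniqueness of the Hamiltonian field. Testing with \<open>(0, p - p')\<close> shows
  \<open>p = p'\<close>; then \<open>m - m'\<close> is tested against itself, with a multiple of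
  \<open>q\<close> as second component to make the test vector tangent.\<close>

lemma sphere_symplectic_nondegenerate:
  fixes S :: "'a::euclidean_space set"
  assumes S: "subspace S" and k: "k > 0"
    and M: "M = {x \<in> S. x \<bullet> x = k}" and ql: "(q, l) \<in> cotangent_bundle M"
    and V: "V \<in> tangent_space (cotangent_bundle M) (q, l)"
    and V': "V' \<in> tangent_space (cotangent_bundle M) (q, l)"
    and eq: "\<And>W. W \<in> tangent_space (cotangent_bundle M) (q, l) \<Longrightarrow>
                symplectic_form W V = symplectic_form W V'"
  shows "V = V'"
proof -
  note T = sphere_tangent_space_cotangent_bundle[OF S k M ql]
  have ql': "q \<in> S" "q \<bullet> q = k"
    using ql unfolding sphere_cotangent_bundle[OF S k M] by auto
  obtain p m p' m' where VV: "V = (p, m)" "V' = (p', m')" by force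
  have p: "p - p' \<in> S" "(p - p') \<bullet> q = 0" and m: "m - m' \<in> S" "(m - m') \<bullet> q + l \<bullet> (p - p') = 0"
    using V V' S unfolding T VV by (auto simp: subspace_diff inner_diff_left inner_diff_right)
  have e: "w \<bullet> (p - p') = (m - m') \<bullet> v"
    if "v \<in> S" "w \<in> S" "v \<bullet> q = 0" "w \<bullet> q + l \<bullet> v = 0" for v w
    using eq[of "(v, w)"] that unfolding T VV symplectic_form_def
    by (simp add: inner_diff_left inner_diff_right)
  have "p - p' = 0" using e[of 0 "p - p'"] p S by (simp add: subspace_0)
  then have "(m - m') \<bullet> q = 0" using m(2) by simp
  moreover have "- ((l \<bullet> (m - m')) / k) *\<^sub>R q \<in> S" using ql' S by (intro subspace_scale)
  ultimately have "(m - m') \<bullet> (m - m') = 0"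
    using e[of "m - m'" "- ((l \<bullet> (m - m')) / k) *\<^sub>R q"] m(1) ql'(2) k \<open>p - p' = 0\<close> by simp
  then show ?thesis using \<open>p - p' = 0\<close> VV by simp
qed

section \<open>The Hamiltonian flow\<close>

text \<open>The four vectors \<open>q\<close>, \<open>q ** X0\<close>, \<open>q ** X1\<close>,
  \<open>q ** X2\<close> are orthogonal, the last three of half the norm of \<open>q\<close>; hence
  the factor 4. Not normalizing \<open>q\<close> allows an application with \<open>q\<close> and
  \<open>l\<close> exchanged.\<close>

lemma quats_expansion:
  assumes "q \<in> quats" "l \<in> quats"
  shows "(q \<bullet> q) *\<^sub>R l = (l \<bullet> q) *\<^sub>R q + 4 *\<^sub>R ((l \<bullet> (q ** X0)) *\<^sub>R (q ** X0) +
           (l \<bullet> (q ** X1)) *\<^sub>R (q ** X1) + (l \<bullet> (q ** X2)) *\<^sub>R (q ** X2))"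
proof -
  obtain a b c d where "q = quat a b" "l = quat c d" using assms by (auto simp: quats_iff)
  then show ?thesis
    by (simp add: mat2_eq_iff mult_mat2 inner_mat2 complex_eq_iff inner_complex_def algebra_simps)
qed

lemma cotangent_bundle_SU2:
  "cotangent_bundle SU2 = {(q, l). q \<in> quats \<and> l \<in> quats \<and> q \<bullet> q = 2 \<and> l \<bullet> q = 0}"
  by (rule sphere_cotangent_bundle[OF subspace_quats _ SU2_eq]) simp

lemma sr_hamiltonian_has_derivative:
  "(sr_hamiltonian has_derivative (\<lambda>W.
      (l \<bullet> (q ** X1)) * (snd W \<bullet> (q ** X1) + l \<bullet> (fst W ** X1)) +
      (l \<bullet> (q ** X2)) * (snd W \<bullet> (q ** X2) + l \<bullet> (fst W ** X2)))) (at (q, l))"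
proof -
  have m: "((\<lambda>z. fst z ** B) has_derivative (\<lambda>W. fst W ** B)) (at (q, l))" for B :: "complex^2^2"
    by (rule bounded_linear.has_derivative[OF bounded_linear_matrix_mult_right has_derivative_fst])
       (rule has_derivative_ident)
  have *: "((\<lambda>z. snd z \<bullet> (fst z ** B)) has_derivative
              (\<lambda>W. snd (q, l) \<bullet> (fst W ** B) + snd W \<bullet> (fst (q, l) ** B))) (at (q, l))" for B :: "complex^2^2"
    by (rule has_derivative_inner[OF has_derivative_snd[OF has_derivative_ident] m])
  show ?thesis
    unfolding sr_hamiltonian_def left_invariant_field_def case_prod_beta
    by (rule derivative_eq_intros * refl)+ (auto simp: algebra_simps)
qed

text \<open>The field is \<open>h1 (q X1, l X1) + h2 (q X2, l X2)\<close>. The form stated here is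
  linear in \<open>q\<close> and \<open>l\<close> as soon as \<open>h\<close> and
  \<open>l \<bullet> l\<close> are known to be constant.\<close>

lemma hamiltonian_field_SU2:
  assumes "(q, l) \<in> cotangent_bundle SU2"
  defines "h \<equiv> l \<bullet> (q ** X0)"
  shows "hamiltonian_field SU2 sr_hamiltonian (q, l) =
    ((1/2) *\<^sub>R l - h *\<^sub>R (q ** X0), - ((l \<bullet> l) / 4) *\<^sub>R q - h *\<^sub>R (l ** X0))"
proof -
  have T: "tangent_space (cotangent_bundle SU2) (q, l) =
      {(v, w). v \<in> quats \<and> w \<in> quats \<and> v \<bullet> q = 0 \<and> w \<bullet> q + l \<bullet> v = 0}"
    by (rule sphere_tangent_space_cotangent_bundle[OF subspace_quats _ SU2_eq assms(1)]) simp
  have ql: "q \<in> quats" "l \<in> quats" "q \<bullet> q = 2" "l \<bullet> q = 0" "q \<bullet> l = 0"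
    using assms(1) by (auto simp: cotangent_bundle_SU2 inner_commute)
  define h1 h2 where "h1 = l \<bullet> (q ** X1)" and "h2 = l \<bullet> (q ** X2)"
  have h: "q \<bullet> (l ** X0) = - h" "q \<bullet> (l ** X1) = - h1" "q \<bullet> (l ** X2) = - h2"
    using mult_X_skew[of l q] by (simp_all add: h_def h1_def h2_def inner_commute)
  have 1: "(1/2) *\<^sub>R l - h *\<^sub>R (q ** X0) = h1 *\<^sub>R (q ** X1) + h2 *\<^sub>R (q ** X2)"
    using arg_cong[OF quats_expansion[OF ql(1,2)], of "\<lambda>x. (1/4) *\<^sub>R x"] ql
    by (simp add: h_def h1_def h2_def algebra_simps)
  \<comment> \<open>Here \<open>q\<close> is expanded in the frame at \<open>l\<close>; skewness
    turns its coefficients into \<open>- h\<close>, \<open>- h1\<close>,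
    \<open>- h2\<close>.\<close>
  have 2: "- ((l \<bullet> l) / 4) *\<^sub>R q - h *\<^sub>R (l ** X0) = h1 *\<^sub>R (l ** X1) + h2 *\<^sub>R (l ** X2)"
    using arg_cong[OF quats_expansion[OF ql(2,1)], of "\<lambda>x. (- 1/4) *\<^sub>R x"] ql h
    by (simp add: algebra_simps)
  let ?V = "(h1 *\<^sub>R (q ** X1) + h2 *\<^sub>R (q ** X2), h1 *\<^sub>R (l ** X1) + h2 *\<^sub>R (l ** X2))"
  have V: "?V \<in> tangent_space (cotangent_bundle SU2) (q, l)"
    unfolding T using ql subspace_quats X_in_quats mult_X_self[of q] mult_X_skew[of l q]
    by (auto intro!: subspace_add subspace_scale quats_mult
        simp: inner_add_left inner_add_right inner_commute)
  have dH: "frechet_derivative sr_hamiltonian (at (q, l)) W = symplectic_form W ?V" for W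
    unfolding frechet_derivative_at[OF sr_hamiltonian_has_derivative, symmetric] symplectic_form_def
    using mult_X_skew[of l "fst W"]
    by (simp add: h1_def h2_def inner_add_left inner_add_right algebra_simps)
  show ?thesis
    unfolding hamiltonian_field_def 1 2
  proof (rule the_equality)
    fix V assume "V \<in> tangent_space (cotangent_bundle SU2) (q, l) \<and>
      (\<forall>W\<in>tangent_space (cotangent_bundle SU2) (q, l).
          symplectic_form W V = frechet_derivative sr_hamiltonian (at (q, l)) W)"
    then show "V = ?V"
      using V dH by (intro sphere_symplectic_nondegenerate[OF subspace_quats _ SU2_eq assms(1)]) auto
  qed (use V dH in auto)
qed

text \<open>The energy \<open>2 n |q|^2 + |l|^2\<close> is conserved. For \<open>n = 0\<close> it
  only controls \<open>l\<close>, so \<open>q\<close> is treated afterwards, using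
  \<open>l = 0\<close>.\<close>

lemma linear_system_unique:
  fixes q l :: "real \<Rightarrow> complex^2^2"
  assumes q: "\<And>t. (q has_vector_derivative (1/2) *\<^sub>R l t - h *\<^sub>R (q t ** X0)) (at t)"
    and l: "\<And>t. (l has_vector_derivative - n *\<^sub>R q t - h *\<^sub>R (l t ** X0)) (at t)"
    and n: "n \<ge> 0" and 0: "q 0 = 0" "l 0 = 0"
  shows "q t = 0" "l t = 0"
proof -
  have "((\<lambda>t. 2 * n * (q t \<bullet> q t) + l t \<bullet> l t) has_real_derivative 0) (at t)" for t
    by (rule derivative_eq_intros has_real_derivative_inner[OF q q] has_real_derivative_inner[OF l l] refl)+
       (use mult_X_self[of "q t"] mult_X_self[of "l t"] in
         \<open>simp add: inner_diff_left inner_diff_right inner_commute\<close>)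
  then have "2 * n * (q t \<bullet> q t) + l t \<bullet> l t = 2 * n * (q 0 \<bullet> q 0) + l 0 \<bullet> l 0" for t
    using DERIV_isconst_all by blast
  then have "2 * n * (q t \<bullet> q t) + l t \<bullet> l t = 0" for t using 0 by simp
  moreover have "2 * n * (q t \<bullet> q t) \<ge> 0" for t using n by simp
  ultimately have l0: "l t = 0" for t
    by (metis add_nonneg_eq_0_iff inner_eq_zero_iff inner_ge_zero)
  have "((\<lambda>t. q t \<bullet> q t) has_real_derivative 0) (at t)" for t
    by (rule DERIV_cong[OF has_real_derivative_inner[OF q q]])
       (use mult_X_self[of "q t"] l0 in \<open>simp add: inner_diff_left inner_diff_right inner_commute\<close>)
  then have "q t \<bullet> q t = q 0 \<bullet> q 0" using DERIV_isconst_all by blast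
  then show "q t = 0" "l t = 0" using 0 l0 by simp_all
qed

text \<open>Right multiplication by the exponential of \<open>- 2 \<theta> X0\<close>, because
  \<open>2 X0\<close> squares to minus the identity.\<close>

definition rot :: "real \<Rightarrow> complex^2^2 \<Rightarrow> complex^2^2" where
  "rot \<theta> A = cos \<theta> *\<^sub>R A - (2 * sin \<theta>) *\<^sub>R (A ** X0)"

text \<open>The case \<open>r = 0\<close> is the limit of \<open>sin (r * t) / r\<close>; it is needed at \<open>l = 0\<close>.\<close>

definition sinq :: "real \<Rightarrow> real \<Rightarrow> real" where
  "sinq r t = (if r = 0 then t else sin (r * t) / r)"

lemma sinq_deriv [derivative_intros]: "(sinq r has_real_derivative cos (r * t)) (at t)"
proof (cases "r = 0")
  case True
  then have "sinq r = (\<lambda>t. t)" by (auto simp: sinq_def)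
  then show ?thesis using True by simp
next
  case False
  then have *: "sinq r = (\<lambda>t. sin (r * t) / r)" by (auto simp: sinq_def)
  show ?thesis unfolding * using False by (auto intro!: derivative_eq_intros)
qed

lemma r_sinq: "r * sinq r t = sin (r * t)"
  by (simp add: sinq_def)

lemma rot_in_quats: "A \<in> quats \<Longrightarrow> rot \<theta> A \<in> quats"
  using subspace_quats X_in_quats unfolding rot_def
  by (intro subspace_diff subspace_scale quats_mult) auto

lemma rot_inner: "rot \<theta> A \<bullet> rot \<theta> B = A \<bullet> B"
proof -
  have s: "(A ** X0) \<bullet> (B ** X0) = (A \<bullet> B) / 4"
    using mult_X_skew(1)[of A "B ** X0"] by (simp add: mult_X0_X0)
  have "rot \<theta> A \<bullet> rot \<theta> B = ((cos \<theta>)\<^sup>2 + (sin \<theta>)\<^sup>2) * (A \<bullet> B)"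
    unfolding rot_def using s mult_X_skew(1)[of A B]
    by (simp add: inner_diff_left inner_diff_right algebra_simps power2_eq_square
        del: sin_cos_squared_add sin_cos_squared_add2 sin_cos_squared_add3)
  then show ?thesis by simp
qed

lemma rot_X0: "rot \<theta> A ** X0 = rot \<theta> (A ** X0)"
  by (simp add: mat2_eq_iff mult_mat2 rot_def complex_eq_iff algebra_simps)

text \<open>Rotation at this speed produces exactly the \<open>X0\<close> term of the field. What
  remains in the rotating frame is an oscillator.\<close>

lemma rot_has_vector_derivative:
  assumes A: "(A has_vector_derivative A') (at t)"
  shows "((\<lambda>t. rot (h * t / 2) (A t)) has_vector_derivative
           rot (h * t / 2) A' - h *\<^sub>R (rot (h * t / 2) (A t) ** X0)) (at t)"
  unfolding rot_def
  apply (rule derivative_eq_intros A bounded_linear.has_vector_derivative[OF bounded_linear_matrix_mult_right A] refl | simp)+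
  apply (simp add: mat2_eq_iff mult_mat2 complex_eq_iff algebra_simps)
  done

text \<open>The solution with \<open>h\<close> and \<open>l \<bullet> l\<close> frozen at their
  initial values. With \<open>l \<bullet> l = 8 r^2\<close> the system in the rotating frame is
  \<open>a' = b / 2\<close>, \<open>b' = - 2 r^2 a\<close>, of frequency \<open>r\<close>.\<close>

definition sr_flow :: "complex^2^2 \<Rightarrow> complex^2^2 \<Rightarrow> real \<Rightarrow> (complex^2^2) \<times> (complex^2^2)" where
  "sr_flow q l t = (let r = sqrt (l \<bullet> l / 8); h = l \<bullet> (q ** X0) in
     (rot (h * t / 2) (cos (r * t) *\<^sub>R q + (sinq r t / 2) *\<^sub>R l),
      rot (h * t / 2) (cos (r * t) *\<^sub>R l - (2 * r\<^sup>2 * sinq r t) *\<^sub>R q)))"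

lemma sr_flow:
  assumes ql: "(q, l) \<in> cotangent_bundle SU2"
  defines "h \<equiv> l \<bullet> (q ** X0)"
  shows sr_flow_in: "sr_flow q l t \<in> cotangent_bundle SU2"
    and sr_flow_fst: "((\<lambda>t. fst (sr_flow q l t)) has_vector_derivative
          (1/2) *\<^sub>R snd (sr_flow q l t) - h *\<^sub>R (fst (sr_flow q l t) ** X0)) (at t)"
    and sr_flow_snd: "((\<lambda>t. snd (sr_flow q l t)) has_vector_derivative
          - ((l \<bullet> l) / 4) *\<^sub>R fst (sr_flow q l t) - h *\<^sub>R (snd (sr_flow q l t) ** X0)) (at t)"
    and sr_flow_h: "snd (sr_flow q l t) \<bullet> (fst (sr_flow q l t) ** X0) = h"
    and sr_flow_norm: "snd (sr_flow q l t) \<bullet> snd (sr_flow q l t) = l \<bullet> l"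
    and sr_flow_0: "sr_flow q l 0 = (q, l)"
proof -
  define r where "r = sqrt (l \<bullet> l / 8)"
  have r2: "l \<bullet> l = 8 * r\<^sup>2" by (simp add: r_def)
  have ql': "q \<in> quats" "l \<in> quats" "q \<bullet> q = 2" "l \<bullet> q = 0" "q \<bullet> l = 0"
    using ql by (auto simp: cotangent_bundle_SU2 inner_commute)
  define C S where "C = (\<lambda>t. cos (r * t))" and "S = sinq r"
  have CS: "(C t)\<^sup>2 + r\<^sup>2 * (S t)\<^sup>2 = 1" for t
    by (simp add: C_def S_def r_sinq flip: power_mult_distrib)
  have C': "(C has_real_derivative - (r\<^sup>2 * S t)) (at t)" for t
    unfolding C_def S_def
    by (auto intro!: derivative_eq_intros simp: power2_eq_square r_sinq mult.assoc)
  have S': "(S has_real_derivative C t) (at t)" for t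
    unfolding C_def S_def by (rule sinq_deriv)
  define a b where "a t = C t *\<^sub>R q + (S t / 2) *\<^sub>R l"
    and "b t = C t *\<^sub>R l - (2 * r\<^sup>2 * S t) *\<^sub>R q" for t
  have flow: "sr_flow q l t = (rot (h * t / 2) (a t), rot (h * t / 2) (b t))" for t
    by (simp add: sr_flow_def a_def b_def C_def S_def r_def h_def Let_def)
  have a': "(a has_vector_derivative (1/2) *\<^sub>R b t) (at t)" for t
    unfolding a_def
    by (auto intro!: derivative_eq_intros C' S' simp: b_def algebra_simps)
  have b': "(b has_vector_derivative (- 2 * r\<^sup>2) *\<^sub>R a t) (at t)" for t
    unfolding b_def
    by (auto intro!: derivative_eq_intros C' S' simp: a_def algebra_simps)
  have rs: "rot \<theta> (c *\<^sub>R A) = c *\<^sub>R rot \<theta> A" for \<theta> c A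
    by (simp add: mat2_eq_iff mult_mat2 rot_def complex_eq_iff algebra_simps)
  show "((\<lambda>t. fst (sr_flow q l t)) has_vector_derivative
          (1/2) *\<^sub>R snd (sr_flow q l t) - h *\<^sub>R (fst (sr_flow q l t) ** X0)) (at t)"
    using rot_has_vector_derivative[OF a', of h t] by (simp only: flow fst_conv snd_conv rs)
  show "((\<lambda>t. snd (sr_flow q l t)) has_vector_derivative
          - ((l \<bullet> l) / 4) *\<^sub>R fst (sr_flow q l t) - h *\<^sub>R (snd (sr_flow q l t) ** X0)) (at t)"
    using rot_has_vector_derivative[OF b', of h t]
    by (simp only: flow fst_conv snd_conv rs) (simp add: r2)
  have aa: "a t \<bullet> a t = 2 * ((C t)\<^sup>2 + r\<^sup>2 * (S t)\<^sup>2)" for t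
    using ql' r2 by (simp add: a_def inner_add_left inner_add_right algebra_simps power2_eq_square)
  have bb: "b t \<bullet> b t = 8 * r\<^sup>2 * ((C t)\<^sup>2 + r\<^sup>2 * (S t)\<^sup>2)" for t
    using ql' r2 by (simp add: b_def inner_diff_left inner_diff_right algebra_simps power2_eq_square)
  have ba: "b t \<bullet> a t = 0" for t
    using ql' r2 by (simp add: a_def b_def inner_diff_left inner_add_right algebra_simps power2_eq_square)
  have in_q: "a t \<in> quats" "b t \<in> quats" for t
    using ql' subspace_quats by (auto simp: a_def b_def intro!: subspace_add subspace_diff subspace_scale)
  show "sr_flow q l t \<in> cotangent_bundle SU2"
    unfolding cotangent_bundle_SU2 flow using in_q aa ba CS by (simp add: rot_inner rot_in_quats)
  show "snd (sr_flow q l t) \<bullet> snd (sr_flow q l t) = l \<bullet> l"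
    using CS bb r2 by (simp add: flow rot_inner)
  have "q \<bullet> (l ** X0) = - h"
    using mult_X_skew(1)[of l q] by (simp add: h_def inner_commute)
  moreover have "(b t) \<bullet> (a t ** X0) = (C t)\<^sup>2 * (l \<bullet> (q ** X0)) + (C t * S t / 2) * (l \<bullet> (l ** X0))
      - (2 * r\<^sup>2 * S t * C t) * (q \<bullet> (q ** X0)) - (r\<^sup>2 * (S t)\<^sup>2) * (q \<bullet> (l ** X0))"
    unfolding a_def b_def
    by (simp add: mult_right_linear inner_diff_left inner_add_right algebra_simps power2_eq_square)
  ultimately have "(b t) \<bullet> (a t ** X0) = h * ((C t)\<^sup>2 + r\<^sup>2 * (S t)\<^sup>2)"
    using mult_X_self by (simp add: algebra_simps h_def)
  then show "snd (sr_flow q l t) \<bullet> (fst (sr_flow q l t) ** X0) = h"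
    using CS by (simp add: flow rot_X0 rot_inner)
  show "sr_flow q l 0 = (q, l)"
    by (simp add: flow a_def b_def C_def S_def rot_def sinq_def)
qed

text \<open>Any integral curve conserves \<open>l \<bullet> l\<close> and \<open>h\<close>, so it
  solves the same linear system as \<open>sr_flow\<close>; their difference starts at 0 and hence
  vanishes.\<close>

lemma integral_curve_eq_sr_flow:
  assumes in_b: "\<And>s. \<gamma> s \<in> cotangent_bundle SU2"
    and d: "\<And>s. (\<gamma> has_vector_derivative hamiltonian_field SU2 sr_hamiltonian (\<gamma> s)) (at s)"
    and 0: "\<gamma> 0 = (q, l)"
  shows "\<gamma> t = sr_flow q l t"
proof -
  define x p h where "x s = fst (\<gamma> s)" and "p s = snd (\<gamma> s)" and "h s = p s \<bullet> (x s ** X0)" for s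
  have g: "\<gamma> s = (x s, p s)" for s by (simp add: x_def p_def)
  have xp: "x s \<bullet> x s = 2" "p s \<bullet> x s = 0" "x s \<bullet> p s = 0" for s
    using in_b[of s] by (auto simp: g cotangent_bundle_SU2 inner_commute)
  note field = hamiltonian_field_SU2[OF in_b[unfolded g], folded h_def]
  have x': "(x has_vector_derivative (1/2) *\<^sub>R p s - h s *\<^sub>R (x s ** X0)) (at s)" for s
    using bounded_linear.has_vector_derivative[OF bounded_linear_fst d, of s]
    by (simp add: g field)
  have p': "(p has_vector_derivative - ((p s \<bullet> p s) / 4) *\<^sub>R x s - h s *\<^sub>R (p s ** X0)) (at s)" for s
    using bounded_linear.has_vector_derivative[OF bounded_linear_snd d, of s]
    by (simp add: g field)
  have "((\<lambda>s. p s \<bullet> p s) has_real_derivative 0) (at s)" for s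
    by (rule DERIV_cong[OF has_real_derivative_inner[OF p' p']])
       (use mult_X_self[of "p s"] xp in \<open>simp add: inner_diff_left inner_diff_right inner_commute\<close>)
  then have pp: "p s \<bullet> p s = p 0 \<bullet> p 0" for s
    using DERIV_isconst_all by blast
  have "(h has_real_derivative 0) (at s)" for s
  proof -
    have sk: "x s \<bullet> (p s ** X0) = - h s" "(p s ** X0) \<bullet> (x s ** X0) = 0"
      using mult_X_skew(1)[of "p s" "x s"] mult_X_skew(1)[of "p s" "x s ** X0"] xp
      by (simp_all add: h_def inner_commute mult_X0_X0)
    show ?thesis
      unfolding h_def[abs_def]
      by (rule DERIV_cong[OF has_real_derivative_inner[OF p'
            bounded_linear.has_vector_derivative[OF bounded_linear_matrix_mult_right x']]])
         (use mult_X_self[of "p s"] mult_X_self[of "x s"] sk xp in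
          \<open>simp add: inner_diff_left inner_diff_right inner_add_right mult_right_linear mult_X0_X0 inner_commute\<close>)
  qed
  then have hh: "h s = h 0" for s
    using DERIV_isconst_all by blast
  have ql: "(q, l) \<in> cotangent_bundle SU2" using in_b[of 0] 0 by simp
  have x0: "x 0 = q" "p 0 = l" using 0 by (auto simp: x_def p_def)
  have h0: "h 0 = l \<bullet> (q ** X0)" by (simp add: h_def x0)
  note F = sr_flow[OF ql, folded h0]
  have *: "((\<lambda>s. x s - fst (sr_flow q l s)) has_vector_derivative
      (1/2) *\<^sub>R (p s - snd (sr_flow q l s)) - h 0 *\<^sub>R ((x s - fst (sr_flow q l s)) ** X0)) (at s)"
    "((\<lambda>s. p s - snd (sr_flow q l s)) has_vector_derivative
      - ((l \<bullet> l) / 4) *\<^sub>R (x s - fst (sr_flow q l s)) - h 0 *\<^sub>R ((p s - snd (sr_flow q l s)) ** X0)) (at s)" for s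
    using has_vector_derivative_diff[OF x' F(2), of s] has_vector_derivative_diff[OF p' F(3), of s]
    by (simp_all add: mult_right_linear hh[of s] pp[of s] x0 algebra_simps)
  have "x t - fst (sr_flow q l t) = 0" "p t - snd (sr_flow q l t) = 0"
    using linear_system_unique[OF *] F(6) x0 by simp_all
  then show ?thesis by (simp add: g prod_eq_iff)
qed

lemma hamiltonian_flow_SU2:
  assumes "(q, l) \<in> cotangent_bundle SU2"
  shows "hamiltonian_flow SU2 sr_hamiltonian t (q, l) = sr_flow q l t"
  unfolding hamiltonian_flow_def
proof (rule the_equality)
  note F = sr_flow[OF assms]
  have "(sr_flow q l has_vector_derivative hamiltonian_field SU2 sr_hamiltonian (sr_flow q l s)) (at s)" for s
    using has_vector_derivative_Pair[OF F(2,3), of s] F(1)[of s]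
      hamiltonian_field_SU2[of "fst (sr_flow q l s)" "snd (sr_flow q l s)"] F(4,5)
    by simp
  then show "\<exists>\<gamma>. (\<forall>s. \<gamma> s \<in> cotangent_bundle SU2 \<and>
            (\<gamma> has_vector_derivative hamiltonian_field SU2 sr_hamiltonian (\<gamma> s)) (at s)) \<and>
         \<gamma> 0 = (q, l) \<and> \<gamma> t = sr_flow q l t"
    using F(1,6) by blast
qed (use integral_curve_eq_sr_flow in blast)

lemma sr_exp_eq:
  assumes "(q, l) \<in> cotangent_bundle SU2"
  defines "r \<equiv> sqrt (l \<bullet> l / 8)"
  shows "sr_exp q l = rot ((l \<bullet> (q ** X0)) / 2) (cos r *\<^sub>R q + (sinq r 1 / 2) *\<^sub>R l)"
  using hamiltonian_flow_SU2[OF assms(1), of 1] by (simp add: sr_exp_def sr_flow_def r_def Let_def)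

section \<open>The exponential map in coordinates\<close>

definition expu :: "real \<Rightarrow> complex \<Rightarrow> complex" where
  "expu a z = (let r = sqrt (a\<^sup>2 + (cmod z)\<^sup>2) in (cos r + \<i> * a * sinq r 1) * cis (- a))"

definition expw :: "real \<Rightarrow> complex \<Rightarrow> complex" where
  "expw a z = (let r = sqrt (a\<^sup>2 + (cmod z)\<^sup>2) in z * sinq r 1 * cis a)"

section \<open>Folds of the coordinate map\<close>

lemma has_vector_derivative_cis:
  assumes "(f has_real_derivative f') (at x)"
  shows "((\<lambda>x. cis (f x)) has_vector_derivative f' *\<^sub>R (\<i> * cis (f x))) (at x)"
  using has_derivative_cis[OF assms[unfolded has_field_derivative_def]]
  by (simp add: has_vector_derivative_def mult.commute)

text \<open>Both end points have larger values than the centre, whereas a continuous injection of an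
  interval is monotone.\<close>

lemma strict_min_not_inj:
  fixes f f' :: "real \<Rightarrow> real"
  assumes d: "d > 0"
    and f: "\<And>y. \<bar>y - x\<bar> \<le> d \<Longrightarrow> (f has_real_derivative f' y) (at y)"
    and s: "\<And>y. \<bar>y - x\<bar> \<le> d \<Longrightarrow> y \<noteq> x \<Longrightarrow> f' y * (y - x) > 0"
  shows "\<not> inj_on f {x - d..x + d}"
proof
  assume inj: "inj_on f {x - d..x + d}"
  have cont: "continuous_on {x - d..x + d} f"
    by (intro continuous_at_imp_continuous_on ballI DERIV_isCont[OF f]) (auto simp: abs_le_iff)
  have "f (x - d) > f x"
  proof (rule DERIV_neg_imp_decreasing_open[where f = f])
    fix y assume "x - d < y" "y < x"
    then show "\<exists>D. (f has_real_derivative D) (at y) \<and> D < 0"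
      using f[of y] s[of y] by (auto simp: abs_le_iff zero_less_mult_iff intro!: exI[of _ "f' y"])
  qed (use d continuous_on_subset[OF cont] in auto)
  moreover have "f (x + d) > f x"
  proof (rule DERIV_pos_imp_increasing_open[where f = f])
    fix y assume "x < y" "y < x + d"
    then show "\<exists>D. (f has_real_derivative D) (at y) \<and> D > 0"
      using f[of y] s[of y] by (auto simp: abs_le_iff zero_less_mult_iff intro!: exI[of _ "f' y"])
  qed (use d continuous_on_subset[OF cont] in auto)
  moreover have "(f (x - d) < f x \<and> f x < f (x + d)) \<or> (f (x + d) < f x \<and> f x < f (x - d))"
    by (rule continuous_inj_imp_mono[OF _ _ cont inj]) (use d in auto)
  ultimately show False by auto
qed

text \<open>The function \<open>(sin y - y cos y) sin r0\<close> vanishes at \<open>r0\<close> and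
  has derivative \<open>y sin y sin r0 > 0\<close>, so it changes sign there.\<close>

lemma fold_sign:
  fixes r0 r :: real
  assumes g: "sin r0 = r0 * cos r0"
    and near: "\<And>y. \<bar>y - r0\<bar> \<le> \<bar>r - r0\<bar> \<Longrightarrow> y > 0 \<and> sin y * sin r0 > 0" and ne: "r \<noteq> r0"
  shows "(sin r - r * cos r) * sin r0 * (r - r0) > 0"
proof -
  define G where "G y = (sin y - y * cos y) * sin r0" for y
  have G': "(G has_real_derivative y * (sin y * sin r0)) (at y)" for y
    unfolding G_def by (auto intro!: derivative_eq_intros simp: algebra_simps)
  have G0: "G r0 = 0" using g by (simp add: G_def)
  show ?thesis
  proof (cases "r > r0")
    case True
    have "G r0 < G r"
      by (rule DERIV_pos_imp_increasing[OF True]) (use G' near True in \<open>fastforce intro: mult_pos_pos\<close>)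
    then show ?thesis using True unfolding G0 by (simp add: G_def)
  next
    case False
    then have lt: "r < r0" using ne by simp
    have "G r < G r0"
      by (rule DERIV_pos_imp_increasing[OF lt]) (use G' near lt in \<open>fastforce intro: mult_pos_pos\<close>)
    then show ?thesis using lt unfolding G0 by (simp add: G_def mult_neg_neg)
  qed
qed

text \<open>Where \<open>expw\<close> is constant, this confines \<open>expu\<close> to a
  circle.\<close>

lemma expu_norm:
  "(cmod (expu a z))\<^sup>2 + (cmod (expw a z))\<^sup>2 = 1"
proof -
  define r where "r = sqrt (a\<^sup>2 + (cmod z)\<^sup>2)"
  have r: "r\<^sup>2 = a\<^sup>2 + (cmod z)\<^sup>2" by (simp add: r_def)
  have "(cmod (expu a z))\<^sup>2 = (cos r)\<^sup>2 + a\<^sup>2 * (sinq r 1)\<^sup>2"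
    unfolding expu_def Let_def r_def[symmetric] norm_mult power_mult_distrib
    by (simp add: cmod_power2 power_mult_distrib)
  moreover have "(cmod (expw a z))\<^sup>2 = (cmod z)\<^sup>2 * (sinq r 1)\<^sup>2"
    unfolding expw_def Let_def r_def[symmetric] norm_mult power_mult_distrib by simp
  ultimately have "(cmod (expu a z))\<^sup>2 + (cmod (expw a z))\<^sup>2 = (cos r)\<^sup>2 + (r * sinq r 1)\<^sup>2"
    by (simp add: r power_mult_distrib algebra_simps)
  then show ?thesis by (simp add: r_sinq)
qed

text \<open>Along the curve \<open>p\<close> the coordinate \<open>expw\<close> is constant, so \<open>expu\<close> has constant modulus;
  its argument has a strict local extremum at \<open>r0\<close>, because its derivative has the sign of
  \<open>sin r - r * cos r\<close> up to a constant.\<close>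

lemma fold_not_inj:
  fixes V :: "(real \<times> complex) set" and \<omega> :: complex
  assumes V: "open V" and inV: "(r0 * c0, r0 * sqrt (1 - c0\<^sup>2) * \<omega>) \<in> V"
    and c0: "c0 \<noteq> 0" "c0\<^sup>2 < 1" and r0: "r0 > 0" "sin r0 \<noteq> 0" "sin r0 = r0 * cos r0"
    and \<omega>: "cmod \<omega> = 1"
  shows "\<not> inj_on (\<lambda>(a, z). (expu a z, expw a z)) V"
proof -
  \<comment> \<open>The value of \<open>expw\<close> at the base point up to its phase. Keeping it
    fixed while \<open>r\<close> varies forces \<open>sqrt (1 - c^2) = K / sin r\<close>, which
    determines \<open>c\<close> up to the sign inherited from \<open>c0\<close>.\<close>
  define K where "K = sqrt (1 - c0\<^sup>2) * sin r0"
  have K2: "K\<^sup>2 > 0" using c0 r0 by (simp add: K_def)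
  define c where "c r = sgn c0 * sqrt (1 - (K / sin r)\<^sup>2)" for r
  \<comment> \<open>The phase of the second component compensates the factor \<open>cis a\<close> of
    \<open>expw\<close>.\<close>
  define p where "p r = (r * c r, cis (r0 * c0 - r * c r) * \<omega> * of_real (r * (K / sin r)))" for r
  define u where "u r = (Complex (cos r) (c r * sin r)) * cis (- (r * c r))" for r
  have Kr0: "K / sin r0 = sqrt (1 - c0\<^sup>2)" using r0 by (simp add: K_def)
  have cr0: "c r0 = c0" using c0 by (simp add: c_def Kr0 sgn_mult_abs)
  have pr0: "p r0 \<in> V" using inV by (simp add: p_def cr0 Kr0 mult_ac)
  have c2: "(c r)\<^sup>2 = 1 - (K / sin r)\<^sup>2" if "(K / sin r)\<^sup>2 < 1" for r
    using that c0(1) by (simp add: c_def power_mult_distrib sgn_if)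
  have E: "expu (fst (p r)) (snd (p r)) = u r" "expw (fst (p r)) (snd (p r)) = \<omega> * cis (r0 * c0) * K"
    and R: "(fst (p r))\<^sup>2 + (cmod (snd (p r)))\<^sup>2 = r\<^sup>2"
    if "r > 0" "sin r \<noteq> 0" "(K / sin r)\<^sup>2 < 1" for r
  proof -
    have "(fst (p r))\<^sup>2 + (cmod (snd (p r)))\<^sup>2 = r\<^sup>2 * ((c r)\<^sup>2 + (K / sin r)\<^sup>2)"
      using \<omega> by (simp add: p_def norm_mult norm_divide power_mult_distrib power_divide algebra_simps)
    then show R: "(fst (p r))\<^sup>2 + (cmod (snd (p r)))\<^sup>2 = r\<^sup>2"
      using c2[OF that(3)] by simp
    have S: "sinq r 1 = sin r / r" using that by (simp add: sinq_def)
    show "expu (fst (p r)) (snd (p r)) = u r"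
      using that unfolding expu_def R by (simp add: S p_def u_def complex_eq_iff)
    have "expw (fst (p r)) (snd (p r)) =
        (cis (r0 * c0 - r * c r) * cis (r * c r)) * \<omega> * of_real (r * (K / sin r) * (sin r / r))"
      using that unfolding expw_def R by (simp add: S p_def)
    also have "\<dots> = \<omega> * cis (r0 * c0) * K"
      using that by (simp add: cis_mult)
    finally show "expw (fst (p r)) (snd (p r)) = \<omega> * cis (r0 * c0) * K" .
  qed
  have c': "(c has_real_derivative (K / sin r)\<^sup>2 * cos r / (sin r * c r)) (at r)"
    if "sin r \<noteq> 0" "(K / sin r)\<^sup>2 < 1" for r
  proof -
    have "sqrt (1 - (K / sin r)\<^sup>2) > 0" using that by simp
    then show ?thesis
      unfolding c_def using that c0(1)
      by (auto intro!: derivative_eq_intros simp: field_simps power2_eq_square sgn_if)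
  qed
  \<comment> \<open>The angular velocity of \<open>u\<close> on its circle.\<close>
  define \<psi>' where "\<psi>' r = (sin r - r * cos r) * (K / sin r)\<^sup>2 / (c r * sin r)" for r
  have cnz: "c r \<noteq> 0" if "(K / sin r)\<^sup>2 < 1" for r
    using that c0(1) by (auto simp: c_def sgn_if)
  have u': "(u has_vector_derivative \<i> * \<psi>' r * u r) (at r)"
    if r: "sin r \<noteq> 0" "(K / sin r)\<^sup>2 < 1" for r
  proof -
    define C where "C = (K / sin r)\<^sup>2 * cos r / (sin r * c r)"
    note cC = c'[OF r, folded C_def]
    have C: "C * c r * sin r = (K / sin r)\<^sup>2 * cos r" using cnz[OF r(2)] r by (simp add: C_def)
    have D: "(u has_vector_derivative Complex (cos r) (c r * sin r) * (- (c r + r * C) *\<^sub>R (\<i> * cis (- (r * c r))))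
            + Complex (- sin r) (C * sin r + c r * cos r) * cis (- (r * c r))) (at r)"
      unfolding u_def
    proof (rule has_vector_derivative_mult)
      show "((\<lambda>r. Complex (cos r) (c r * sin r)) has_vector_derivative
          Complex (- sin r) (C * sin r + c r * cos r)) (at r)"
        unfolding has_vector_derivative_complex_iff
        using cC by (auto intro!: derivative_eq_intros)
      show "((\<lambda>r. cis (- (r * c r))) has_vector_derivative - (c r + r * C) *\<^sub>R (\<i> * cis (- (r * c r)))) (at r)"
        by (rule has_vector_derivative_cis) (use cC in \<open>auto intro!: derivative_eq_intros\<close>)
    qed
    have "Complex (cos r) (c r * sin r) * (- (c r + r * C) *\<^sub>R \<i>) + Complex (- sin r) (C * sin r + c r * cos r)
      = \<i> * \<psi>' r * Complex (cos r) (c r * sin r)"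
    proof (rule complex_eqI)
      have "c r * sin r * (c r + r * C) - sin r = sin r * ((c r)\<^sup>2 - 1) + r * (C * c r * sin r)"
        by (simp add: algebra_simps power2_eq_square)
      also have "\<dots> = - ((sin r - r * cos r) * (K / sin r)\<^sup>2)"
        unfolding C c2[OF r(2)] by (simp add: algebra_simps)
      also have "\<dots> = - (\<psi>' r * (c r * sin r))"
        using cnz[OF r(2)] r by (simp add: \<psi>'_def)
      finally show "Re (Complex (cos r) (c r * sin r) * (- (c r + r * C) *\<^sub>R \<i>) + Complex (- sin r) (C * sin r + c r * cos r))
        = Re (\<i> * \<psi>' r * Complex (cos r) (c r * sin r))" by (simp add: algebra_simps)
      have "\<psi>' r * cos r = C * (sin r - r * cos r)"
        by (simp add: \<psi>'_def C_def mult_ac)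
      then show "Im (Complex (cos r) (c r * sin r) * (- (c r + r * C) *\<^sub>R \<i>) + Complex (- sin r) (C * sin r + c r * cos r))
        = Im (\<i> * \<psi>' r * Complex (cos r) (c r * sin r))" by (simp add: algebra_simps)
    qed
    moreover have "M * (k *\<^sub>R (\<i> * E)) + N * E = (M * (k *\<^sub>R \<i>) + N) * E" for M N E :: complex and k :: real
      by (simp add: algebra_simps)
    ultimately show ?thesis
      using D by (simp only: u_def mult.assoc)
  qed
  have ok0: "(K / sin r0)\<^sup>2 < 1" unfolding Kr0 using c0 by simp
  \<comment> \<open>The circle does not degenerate to a point, since \<open>expw\<close> has modulus
    less than 1.\<close>
  have u0: "u r0 \<noteq> 0"
  proof -
    have "(cmod (\<omega> * cis (r0 * c0) * K))\<^sup>2 = (1 - c0\<^sup>2) * (sin r0)\<^sup>2"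
      using \<omega> c0 by (simp add: norm_mult K_def power_mult_distrib)
    also have "\<dots> < 1"
      using c0 mult_left_mono[of "(sin r0)\<^sup>2" 1 "1 - c0\<^sup>2"] abs_sin_le_one[of r0]
      by (simp add: abs_square_le_1 less_le_trans[of _ "1 - c0\<^sup>2" 1] le_less_trans[of _ "1 - c0\<^sup>2" 1])
    finally show ?thesis
      using expu_norm[of "fst (p r0)" "snd (p r0)"] E[OF r0(1,2) ok0] by auto
  qed
  have contc: "isCont c r0" using c'[OF r0(2) ok0] by (rule DERIV_isCont)
  have contu: "isCont u r0"
    using u'[OF r0(2) ok0] by (rule has_vector_derivative_continuous)
  have contp: "isCont p r0"
    using contc r0 unfolding p_def isCont_def by (intro tendsto_intros) auto
  have "\<forall>\<^sub>F r in nhds r0. r > 0 \<and> sin r * sin r0 > 0 \<and> (K / sin r)\<^sup>2 < 1 \<and>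
          Re (u r * cnj (u r0)) > 0 \<and> p r \<in> V"
  proof (intro eventually_conj)
    have ident: "((\<lambda>r. r) \<longlongrightarrow> r0) (nhds r0)" by (rule filterlim_ident)
    show "\<forall>\<^sub>F r in nhds r0. r > 0"
      using order_tendstoD(1)[OF ident r0(1)] .
    have "((\<lambda>r. sin r * sin r0) \<longlongrightarrow> sin r0 * sin r0) (nhds r0)"
      by (intro tendsto_intros ident)
    moreover have "sin r0 * sin r0 > 0" using r0(2) by (auto simp: zero_less_mult_iff)
    ultimately show "\<forall>\<^sub>F r in nhds r0. sin r * sin r0 > 0"
      by (rule order_tendstoD(1))
    have "((\<lambda>r. (K / sin r)\<^sup>2) \<longlongrightarrow> (K / sin r0)\<^sup>2) (nhds r0)"
      by (intro tendsto_intros ident r0(2))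
    then show "\<forall>\<^sub>F r in nhds r0. (K / sin r)\<^sup>2 < 1"
      using ok0 by (rule order_tendstoD(2))
    have "(u \<longlongrightarrow> u r0) (nhds r0)"
      using contu by (simp add: isCont_def tendsto_at_iff_tendsto_nhds)
    then have "((\<lambda>r. Re (u r * cnj (u r0))) \<longlongrightarrow> Re (u r0 * cnj (u r0))) (nhds r0)"
      by (intro tendsto_intros)
    moreover have "Re (u r0 * cnj (u r0)) > 0"
      using u0 by (simp add: complex_mult_cnj complex_neq_0)
    ultimately show "\<forall>\<^sub>F r in nhds r0. Re (u r * cnj (u r0)) > 0"
      by (rule order_tendstoD(1))
    have "(p \<longlongrightarrow> p r0) (nhds r0)"
      using contp by (simp add: isCont_def tendsto_at_iff_tendsto_nhds)
    then show "\<forall>\<^sub>F r in nhds r0. p r \<in> V"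
      using V pr0 by (rule topological_tendstoD)
  qed
  then obtain e where e: "e > 0" "\<And>r. dist r r0 < e \<Longrightarrow> r > 0 \<and> sin r * sin r0 > 0 \<and> (K / sin r)\<^sup>2 < 1 \<and>
          Re (u r * cnj (u r0)) > 0 \<and> p r \<in> V"
    unfolding eventually_nhds_metric by blast
  define d where "d = e / 2"
  have ok: "r > 0" "sin r \<noteq> 0" "sin r * sin r0 > 0" "(K / sin r)\<^sup>2 < 1" "Re (u r * cnj (u r0)) > 0" "p r \<in> V"
    if "\<bar>r - r0\<bar> \<le> d" for r
    using e(2)[of r] that e(1) by (auto simp: dist_real_def d_def)
  \<comment> \<open>A substitute for the argument of \<open>u\<close>: the imaginary part relative
    to \<open>u r0\<close> is a coordinate of the circle where the real part is positive. The factor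
    \<open>c0\<close> makes the extremum a minimum.\<close>
  define f where "f r = c0 * Im (u r * cnj (u r0))" for r
  have "\<not> inj_on f {r0 - d..r0 + d}"
  proof (rule strict_min_not_inj[where f' = "\<lambda>r. c0 * (\<psi>' r * Re (u r * cnj (u r0)))"])
    show "d > 0" using e by (simp add: d_def)
  next
    fix r assume r: "\<bar>r - r0\<bar> \<le> d"
    have "((\<lambda>r. u r * cnj (u r0)) has_vector_derivative (\<i> * \<psi>' r * u r) * cnj (u r0)) (at r)"
      by (rule bounded_linear.has_vector_derivative[OF bounded_linear_mult_left u'])
         (use ok[OF r] in auto)
    from bounded_linear.has_vector_derivative[OF bounded_linear_Im this]
    have "((\<lambda>r. Im (u r * cnj (u r0))) has_real_derivative \<psi>' r * Re (u r * cnj (u r0))) (at r)"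
      by (simp add: has_real_derivative_iff_has_vector_derivative algebra_simps)
    then show "(f has_real_derivative c0 * (\<psi>' r * Re (u r * cnj (u r0)))) (at r)"
      unfolding f_def by (rule DERIV_cmult)
  next
    fix r assume r: "\<bar>r - r0\<bar> \<le> d" "r \<noteq> r0"
    have 1: "(sin r - r * cos r) * sin r0 * (r - r0) > 0"
      by (rule fold_sign[OF r0(3)]) (use r ok in auto)
    have "c0 * c r > 0"
      using ok(4)[OF r(1)] c0 by (simp add: c_def mult.assoc[symmetric] abs_sgn[symmetric])
    then have 2: "c0 / c r > 0" by (simp add: zero_less_mult_iff zero_less_divide_iff)
    have 3: "1 / (sin r * sin r0) > 0" using ok(3)[OF r(1)] by simp
    have 4: "(K / sin r)\<^sup>2 > 0" using K2 ok(2)[OF r(1)] by simp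
    have "((sin r - r * cos r) * sin r0 * (r - r0)) * (c0 / c r) * (1 / (sin r * sin r0)) *
        (K / sin r)\<^sup>2 * Re (u r * cnj (u r0)) > 0"
      by (rule mult_pos_pos[OF mult_pos_pos[OF mult_pos_pos[OF mult_pos_pos[OF 1 2] 3] 4] ok(5)[OF r(1)]])
    also have "\<dots> = c0 * (\<psi>' r * Re (u r * cnj (u r0))) * (r - r0)"
      using r0 by (simp add: \<psi>'_def)
    finally show "c0 * (\<psi>' r * Re (u r * cnj (u r0))) * (r - r0) > 0" .
  qed
  then obtain r1 r2 where r12': "r1 \<in> {r0 - d..r0 + d}" "r2 \<in> {r0 - d..r0 + d}" "r1 \<noteq> r2" "f r1 = f r2"
    unfolding inj_on_def by blast
  then have r12: "\<bar>r1 - r0\<bar> \<le> d" "\<bar>r2 - r0\<bar> \<le> d" "r1 \<noteq> r2" "f r1 = f r2"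
    by (auto simp: abs_le_iff)
  have cu: "(cmod (u r))\<^sup>2 = 1 - (cmod (\<omega> * cis (r0 * c0) * K))\<^sup>2" if "\<bar>r - r0\<bar> \<le> d" for r
    using expu_norm[of "fst (p r)" "snd (p r)"] E[of r] ok[OF that] by simp
  \<comment> \<open>Equal moduli, equal imaginary parts and positive real parts give
    \<open>u r1 = u r2\<close>.\<close>
  have Im: "Im (u r1 * cnj (u r0)) = Im (u r2 * cnj (u r0))" using r12(4) c0 by (simp add: f_def)
  have "cmod (u r1) = cmod (u r2)"
    using cu[OF r12(1)] cu[OF r12(2)] by (metis norm_ge_zero power2_eq_imp_eq)
  then have "(cmod (u r1 * cnj (u r0)))\<^sup>2 = (cmod (u r2 * cnj (u r0)))\<^sup>2" by (simp add: norm_mult)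
  then have "(Re (u r1 * cnj (u r0)))\<^sup>2 = (Re (u r2 * cnj (u r0)))\<^sup>2"
    using Im by (simp only: cmod_power2)
  then have "Re (u r1 * cnj (u r0)) = Re (u r2 * cnj (u r0))"
    using ok(5)[OF r12(1)] ok(5)[OF r12(2)] by (metis less_imp_le power2_eq_imp_eq)
  then have "u r1 = u r2" using Im u0 by (metis complex_cnj_zero_iff complex_eqI mult_cancel_right)
  \<comment> \<open>The parameter \<open>r\<close> is recovered from \<open>p r\<close> as its
    norm.\<close>
  moreover have "p r1 \<noteq> p r2"
    using R[of r1] R[of r2] ok[OF r12(1)] ok[OF r12(2)] r12(3) by (metis less_imp_le power2_eq_imp_eq)
  ultimately show ?thesis
    using ok[OF r12(1)] ok[OF r12(2)] E[of r1] E[of r2]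
    by (auto simp: case_prod_beta dest: inj_onD[of _ _ "p r1" "p r2"])
qed


text \<open>Otherwise the derivative of \<open>expu\<close> yields \<open>\<alpha> a = r r'\<close>
  and \<open>\<alpha> r = a r'\<close>, with \<open>r'\<close> the derivative of the radius. Then
  \<open>\<alpha> (r^2 - a^2) = 0\<close>, so \<open>\<alpha> = 0\<close> off the axis,
  \<open>r' = 0\<close>, and the derivative of \<open>expw\<close> reduces to a nonzero multiple of
  \<open>\<zeta>\<close>.\<close>

lemma critical_imp_sin_eq:
  fixes a \<alpha> :: real and z \<zeta> :: complex
  defines "r \<equiv> sqrt (a\<^sup>2 + (cmod z)\<^sup>2)"
  assumes z: "z \<noteq> 0" and s: "sin r \<noteq> 0" and ne: "(\<alpha>, \<zeta>) \<noteq> (0, 0)"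
    and u: "((\<lambda>t. expu (a + t * \<alpha>) (z + of_real t * \<zeta>)) has_vector_derivative 0) (at 0)"
    and w: "((\<lambda>t. expw (a + t * \<alpha>) (z + of_real t * \<zeta>)) has_vector_derivative 0) (at 0)"
  shows "sin r = r * cos r"
proof (rule ccontr)
  assume g: "sin r \<noteq> r * cos r"
  have r0: "r > 0" using z by (simp add: r_def add_nonneg_pos)
  have r2: "r\<^sup>2 = a\<^sup>2 + (cmod z)\<^sup>2" by (simp add: r_def)
  define R where "R t = sqrt ((a + t * \<alpha>)\<^sup>2 + (cmod (z + of_real t * \<zeta>))\<^sup>2)" for t
  have R0: "R 0 = r" by (simp add: R_def r_def)
  have R': "\<exists>r'. (R has_real_derivative r') (at 0)"
  proof -
    have R: "R = (\<lambda>t. sqrt ((a + t * \<alpha>)\<^sup>2 + ((Re z + t * Re \<zeta>)\<^sup>2 + (Im z + t * Im \<zeta>)\<^sup>2)))"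
      by (rule ext) (simp add: R_def cmod_power2)
    have pos: "a\<^sup>2 + ((Re z)\<^sup>2 + (Im z)\<^sup>2) > 0"
      using r2 r0 zero_less_power[OF r0, of 2] by (simp only: cmod_power2)
    have "((\<lambda>t. (a + t * \<alpha>)\<^sup>2 + ((Re z + t * Re \<zeta>)\<^sup>2 + (Im z + t * Im \<zeta>)\<^sup>2)) has_real_derivative
        2 * a * \<alpha> + (2 * Re z * Re \<zeta> + 2 * Im z * Im \<zeta>)) (at 0)"
      by (auto intro!: derivative_eq_intros)
    from DERIV_chain2[OF DERIV_real_sqrt this] show ?thesis
      unfolding R using pos by auto
  qed
  then obtain r' where r': "(R has_real_derivative r') (at 0)" by blast
  \<comment> \<open>Near 0 the radius is positive, so this quotient agrees with
    \<open>sinq (R t) 1\<close>.\<close>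
  define S where "S t = sin (R t) / R t" for t
  define S' where "S' = (r * cos r - sin r) * r' / r\<^sup>2"
  have S0: "S 0 = sin r / r" by (simp add: S_def R0)
  have S': "(S has_real_derivative S') (at 0)"
    unfolding S_def S'_def using r0
    by (auto intro!: derivative_eq_intros r' simp: R0 power2_eq_square algebra_simps)
  have ev: "\<forall>\<^sub>F t in nhds 0. sinq (R t) 1 = S t"
  proof -
    have "(R \<longlongrightarrow> R 0) (nhds 0)"
      using DERIV_isCont[OF r'] by (simp add: isCont_def tendsto_at_iff_tendsto_nhds)
    then have "\<forall>\<^sub>F t in nhds 0. R t > 0" using r0 unfolding R0 by (rule order_tendstoD(1))
    then show ?thesis by eventually_elim (simp add: sinq_def S_def)
  qed
  have cong: "(f has_vector_derivative D) (at 0)"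
    if "(h has_vector_derivative D) (at 0)" "\<forall>\<^sub>F t in nhds 0. f t = h t" for f h :: "real \<Rightarrow> complex" and D
    using that has_vector_derivative_cong_ev[of UNIV f h 0] eventually_nhds_x_imp_x[OF that(2)] by simp
  \<comment> \<open>The velocity of \<open>expu\<close> without its phase \<open>cis (- a)\<close>;
    its real and imaginary parts are the two equations used below.\<close>
  define U where "U = Complex (- sin r * r') (\<alpha> * S 0 + a * S' - \<alpha> * cos r) + \<alpha> * a * S 0"
  have U': "((\<lambda>t. Complex (cos (R t)) ((a + t * \<alpha>) * S t) * cis (- (a + t * \<alpha>))) has_vector_derivative U * cis (- a)) (at 0)"
  proof (rule has_vector_derivative_eq_rhs)
    show "((\<lambda>t. Complex (cos (R t)) ((a + t * \<alpha>) * S t) * cis (- (a + t * \<alpha>))) has_vector_derivative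
        Complex (cos (R 0)) ((a + 0 * \<alpha>) * S 0) * ((- \<alpha>) *\<^sub>R (\<i> * cis (- (a + 0 * \<alpha>)))) +
        Complex (- sin r * r') (\<alpha> * S 0 + a * S') * cis (- (a + 0 * \<alpha>))) (at 0)"
    proof (rule has_vector_derivative_mult)
      show "((\<lambda>t. Complex (cos (R t)) ((a + t * \<alpha>) * S t)) has_vector_derivative
          Complex (- sin r * r') (\<alpha> * S 0 + a * S')) (at 0)"
        unfolding has_vector_derivative_complex_iff
        by (auto intro!: derivative_eq_intros r' S' simp: R0)
      show "((\<lambda>t. cis (- (a + t * \<alpha>))) has_vector_derivative (- \<alpha>) *\<^sub>R (\<i> * cis (- (a + 0 * \<alpha>)))) (at 0)"
        by (rule has_vector_derivative_cis) (auto intro!: derivative_eq_intros)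
    qed
    have "Complex (cos r) (a * S 0) * ((- \<alpha>) *\<^sub>R \<i>) + Complex (- sin r * r') (\<alpha> * S 0 + a * S') = U"
      by (simp add: U_def complex_eq_iff)
    moreover have "M * (k *\<^sub>R (\<i> * E)) + N * E = (M * (k *\<^sub>R \<i>) + N) * E" for M N E :: complex and k :: real
      by (simp add: algebra_simps)
    ultimately show "Complex (cos (R 0)) ((a + 0 * \<alpha>) * S 0) * ((- \<alpha>) *\<^sub>R (\<i> * cis (- (a + 0 * \<alpha>)))) +
        Complex (- sin r * r') (\<alpha> * S 0 + a * S') * cis (- (a + 0 * \<alpha>)) = U * cis (- a)"
      by (simp only: R0 mult_zero_left add_0_right)
  qed
  have "((\<lambda>t. expu (a + t * \<alpha>) (z + of_real t * \<zeta>)) has_vector_derivative U * cis (- a)) (at 0)"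
    by (rule cong[OF U'], rule eventually_mono[OF ev])
       (simp add: expu_def R_def[symmetric] complex_eq_iff)
  then have "U * cis (- a) = 0" using u by (rule vector_derivative_unique_at)
  then have "U = 0" by simp
  then have 1: "\<alpha> * a * S 0 = sin r * r'" and 2: "\<alpha> * S 0 + a * S' = \<alpha> * cos r"
    by (auto simp: U_def complex_eq_iff)
  have 3: "\<alpha> * a = r * r'" using 1 r0 s by (simp add: S0 field_simps)
  have "(sin r - r * cos r) * (\<alpha> * r - a * r') = 0"
    using 2 r0 by (simp add: S0 S'_def field_simps power2_eq_square)
  then have "\<alpha> * r = a * r'" using g by simp
  then have "\<alpha> * r * r = a * (r * r')" by simp
  then have "\<alpha> * r\<^sup>2 = \<alpha> * a\<^sup>2" unfolding 3[symmetric] by (simp add: power2_eq_square)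
  then have \<alpha>: "\<alpha> = 0" using r2 z by simp
  then have r'0: "r' = 0" using 3 r0 by simp
  have W': "((\<lambda>t. (z + of_real t * \<zeta>) * of_real (S t) * cis (a + t * \<alpha>)) has_vector_derivative \<zeta> * S 0 * cis a) (at 0)"
  proof -
    have "((\<lambda>t. (z + of_real t * \<zeta>) * of_real (S t)) has_vector_derivative \<zeta> * S 0) (at 0)"
      using S' by (auto intro!: derivative_eq_intros simp: S'_def r'0)
    then show ?thesis
      unfolding \<alpha> by (simp add: has_vector_derivative_mult_left)
  qed
  have "((\<lambda>t. expw (a + t * \<alpha>) (z + of_real t * \<zeta>)) has_vector_derivative \<zeta> * S 0 * cis a) (at 0)"
    by (rule cong[OF W'], rule eventually_mono[OF ev])
       (simp add: expw_def R_def[symmetric])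
  then have "\<zeta> * S 0 * cis a = 0" using w by (rule vector_derivative_unique_at)
  then have "\<zeta> = 0" using r0 s by (simp add: S0)
  then show False using ne \<alpha> by simp
qed

text \<open>Each kind of singularity has its own coincidence of values: sliding along the axis,
  rotating \<open>z\<close>, or a fold. Openness of \<open>V\<close> keeps the second point in
  \<open>V\<close>.\<close>

lemma critical_not_inj:
  fixes V :: "(real \<times> complex) set"
  assumes V: "open V" "(a, z) \<in> V" and ne: "(\<alpha>, \<zeta>) \<noteq> (0, 0)"
    and u: "((\<lambda>t. expu (a + t * \<alpha>) (z + of_real t * \<zeta>)) has_vector_derivative 0) (at 0)"
    and w: "((\<lambda>t. expw (a + t * \<alpha>) (z + of_real t * \<zeta>)) has_vector_derivative 0) (at 0)"
  shows "\<not> inj_on (\<lambda>(a, z). (expu a z, expw a z)) V"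
proof -
  define r where "r = sqrt (a\<^sup>2 + (cmod z)\<^sup>2)"
  have near: "\<forall>\<^sub>F t in at x. p t \<in> V" if "p x \<in> V" "isCont p x" for p and x :: real
    using that V(1) unfolding isCont_def by (auto intro: topological_tendstoD)
  consider (axis) "z = 0" | (sin) "z \<noteq> 0" "sin r = 0" | (fold) "z \<noteq> 0" "sin r \<noteq> 0" by blast
  then show ?thesis
  proof cases
    case axis
    have "\<forall>\<^sub>F b in at a. (b, z) \<in> V"
      by (rule near) (use V(2) in \<open>auto intro!: continuous_intros\<close>)
    then have "\<forall>\<^sub>F b in at a. (b, z) \<in> V \<and> b \<noteq> a"
      by (simp add: eventually_at_filter eventually_conj_iff)
    then obtain b where b: "(b, z) \<in> V" "b \<noteq> a"
      using eventually_happens'[OF trivial_limit_at] by blast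
    have "expu c 0 = 1" "expw c 0 = 0" for c
    proof -
      \<comment> \<open>On the axis the radius is \<open>\<bar>c\<bar>\<close>; both functions are
        even in it, so the first factor of \<open>expu\<close> is \<open>cis c\<close>.\<close>
      have *: "cos \<bar>c\<bar> = cos c" "c * sinq \<bar>c\<bar> 1 = sin c" by (simp_all add: sinq_def abs_if)
      have "expu c 0 = cis c * cis (- c)"
        unfolding expu_def Let_def by (simp add: * cis_mult complex_eq_iff)
      then show "expu c 0 = 1" by (simp add: cis_mult)
    qed (simp add: expw_def Let_def)
    then show ?thesis using b V(2) axis by (auto dest: inj_onD[of _ _ "(a, z)" "(b, z)"])
  next
    case sin
    have "\<forall>\<^sub>F t in at 0. (a, cis t * z) \<in> V"
    proof (rule near)
      show "isCont (\<lambda>t. (a, cis t * z)) 0"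
        unfolding isCont_def by (intro tendsto_intros)
    qed (use V(2) in simp)
    moreover have "\<forall>\<^sub>F t in at 0. t \<in> {-1<..<1} - {0::real}"
      by (rule eventually_at_in_open) auto
    ultimately have "\<forall>\<^sub>F t in at 0. (a, cis t * z) \<in> V \<and> t \<in> {-1<..<1} \<and> t \<noteq> 0"
      by eventually_elim auto
    then obtain t where t: "(a, cis t * z) \<in> V" "-1 < t" "t < 1" "t \<noteq> 0"
      using eventually_happens'[OF trivial_limit_at] by fastforce
    \<comment> \<open>The bound 1 on \<open>\<bar>t\<bar>\<close> stays below \<open>pi\<close>, so
      the rotation by \<open>t\<close> is not trivial.\<close>
    have "sin t \<noteq> 0" using t pi_gt3 sin_gt_zero[of t] sin_gt_zero[of "-t"] by (cases "t > 0") auto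
    then have "cis t * z \<noteq> z" using sin by (auto simp: complex_eq_iff[of "cis t" 1])
    moreover have "r > 0" using sin by (simp add: r_def add_nonneg_pos)
    then have "sinq r 1 = 0" using sin by (simp add: sinq_def)
    then have "expu a (cis t * z) = expu a z" "expw a (cis t * z) = expw a z"
      by (simp_all add: expu_def expw_def norm_mult flip: r_def)
    ultimately show ?thesis
      using t V(2) by (auto dest: inj_onD[of _ _ "(a, z)" "(a, cis t * z)"])
  next
    case fold
    have crit: "sin r = r * cos r"
      using critical_imp_sin_eq[OF fold(1) _ ne u w] fold(2) by (simp add: r_def)
    have r0: "r > 0" using fold by (simp add: r_def add_nonneg_pos)
    have r2: "r\<^sup>2 = a\<^sup>2 + (cmod z)\<^sup>2" by (simp add: r_def)
    define c0 where "c0 = a / r"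
    have a: "a = r * c0" using r0 by (simp add: c0_def)
    have "(cmod z)\<^sup>2 = r\<^sup>2 - a\<^sup>2" using r2 by simp
    then have sq: "1 - c0\<^sup>2 = (cmod z / r)\<^sup>2"
      using r0 by (simp only: power_divide c0_def) (simp add: diff_divide_distrib)
    have c0: "c0\<^sup>2 < 1" using sq fold r0 by (smt (verit) zero_less_norm_iff divide_pos_pos zero_less_power)
    have "sqrt (1 - c0\<^sup>2) = cmod z / r" unfolding sq using r0 by simp
    then have z: "of_real r * of_real (sqrt (1 - c0\<^sup>2)) * sgn z = z"
      using r0 fold by (simp add: sgn_eq)
    \<comment> \<open>The fold needs \<open>a \<noteq> 0\<close>. If \<open>a = 0\<close>, the point
      is moved within the sphere of radius \<open>r\<close>, which preserves the equation
      \<open>sin r = r cos r\<close>.\<close>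
    have "\<exists>c. c \<noteq> 0 \<and> c\<^sup>2 < 1 \<and> (r * c, r * sqrt (1 - c\<^sup>2) * sgn z) \<in> V"
    proof (cases "c0 = 0")
      case True
      have "\<forall>\<^sub>F c in at 0. (r * c, of_real r * of_real (sqrt (1 - c\<^sup>2)) * sgn z) \<in> V"
        by (rule near) (use V(2) a z True in \<open>auto intro!: continuous_intros\<close>)
      moreover have "\<forall>\<^sub>F t in at 0. t \<in> {-1<..<1} - {0::real}"
        by (rule eventually_at_in_open) auto
      ultimately have "\<forall>\<^sub>F c in at 0. c \<noteq> 0 \<and> c\<^sup>2 < 1 \<and> (r * c, of_real r * of_real (sqrt (1 - c\<^sup>2)) * sgn z) \<in> V"
        by eventually_elim (auto simp: abs_square_less_1)
      then show ?thesis
        using eventually_happens'[OF trivial_limit_at] by fastforce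
    next
      case False
      then show ?thesis using c0 V(2) a z by auto
    qed
    then obtain c where "c \<noteq> 0" "c\<^sup>2 < 1" "(r * c, r * sqrt (1 - c\<^sup>2) * sgn z) \<in> V" by blast
    then show ?thesis
      using fold_not_inj[OF V(1) _ _ _ r0 fold(2) crit] fold by (simp add: norm_sgn)
  qed
qed

section \<open>Transfer to the cotangent spaces of SU(2)\<close>

text \<open>The factor 2 makes \<open>l \<bullet> (q ** X0) = 2 * a\<close> and \<open>l \<bullet> l / 8 = a\<^sup>2 + |z|\<^sup>2\<close> for \<open>l = covec q a z\<close>.\<close>

definition covec :: "complex^2^2 \<Rightarrow> real \<Rightarrow> complex \<Rightarrow> complex^2^2" where
  "covec q a z = q ** quat (2 * \<i> * a) (2 * z)"

text \<open>Left translation is an isometry, because the quaternion norm is multiplicative; inner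
  products may thus be computed at the identity.\<close>

lemma SU2_mult_inner:
  assumes "q \<in> SU2" "A \<in> quats" "B \<in> quats"
  shows "(q ** A) \<bullet> (q ** B) = A \<bullet> B"
proof -
  obtain a b c d e f where *: "q = quat a b" "A = quat c d" "B = quat e f"
    using assms by (auto simp: SU2_eq quats_iff)
  have n: "(Re a)\<^sup>2 + (Im a)\<^sup>2 + (Re b)\<^sup>2 + (Im b)\<^sup>2 = 1"
    using assms(1) unfolding * SU2_eq by (simp add: quat_inner inner_complex_def power2_eq_square)
  have "(q ** A) \<bullet> (q ** B) = ((Re a)\<^sup>2 + (Im a)\<^sup>2 + (Re b)\<^sup>2 + (Im b)\<^sup>2) * (A \<bullet> B)"
    by (simp add: * quat_mult quat_inner inner_complex_def power2_eq_square algebra_simps)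
  then show ?thesis by (simp add: n)
qed

lemma SU2_inverse:
  assumes "q \<in> SU2"
  obtains p where "p \<in> quats" "p ** q = mat 1" "q ** p = mat 1"
proof -
  obtain a b where q: "q = quat a b" and n: "a \<bullet> a + b \<bullet> b = 1"
    using assms by (auto simp: SU2_eq quats_iff quat_inner)
  have n: "a * cnj a + b * cnj b = 1"
    using n by (simp add: complex_eq_iff inner_complex_def algebra_simps)
  have m: "mat 1 = quat 1 0" by (simp add: mat2_eq_iff mat_def)
  show ?thesis
    by (rule that[of "quat (cnj a) (- b)"]) (use n in \<open>simp_all add: m q quat_mult algebra_simps\<close>)
qed

lemma cotangent_space_SU2:
  assumes "q \<in> SU2"
  shows "l \<in> cotangent_space SU2 q \<longleftrightarrow> (q, l) \<in> cotangent_bundle SU2"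
  using assms by (simp add: cotangent_bundle_def)

lemma covec_in_bundle:
  assumes "q \<in> SU2"
  shows "(q, covec q a z) \<in> cotangent_bundle SU2"
proof -
  have "covec q a z \<bullet> (q ** quat 1 0) = 0"
    unfolding covec_def SU2_mult_inner[OF assms quat_in_quats quat_in_quats]
    by (simp add: quat_inner inner_complex_def)
  moreover have "q ** quat 1 0 = q" by (simp add: mat2_eq_iff mult_mat2)
  ultimately show ?thesis
    using assms unfolding cotangent_bundle_SU2 by (auto simp: SU2_eq covec_def intro: quats_mult)
qed

text \<open>Translated to the identity, \<open>l \<bullet> q = 0\<close> says that the diagonal
  entry is purely imaginary.\<close>

lemma cotangent_space_SU2_eq_range:
  assumes q: "q \<in> SU2"
  shows "cotangent_space SU2 q = range (\<lambda>(a, z). covec q a z)"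
proof (intro set_eqI iffI)
  fix l assume "l \<in> cotangent_space SU2 q"
  then have l: "l \<in> quats" "l \<bullet> q = 0"
    by (auto simp: cotangent_space_SU2[OF q] cotangent_bundle_SU2)
  obtain p where p: "p \<in> quats" "q ** p = mat 1" using SU2_inverse[OF q] by blast
  obtain e f where ef: "p ** l = quat e f"
    using quats_mult[OF p(1) l(1)] by (auto simp: quats_iff)
  have ql: "q ** quat e f = l"
    unfolding ef[symmetric] by (simp add: matrix_mul_assoc p(2))
  have "q ** quat 1 0 = q" by (simp add: mat2_eq_iff mult_mat2)
  then have "quat e f \<bullet> quat 1 0 = 0"
    using SU2_mult_inner[OF q, of "quat e f" "quat 1 0"] ql l by simp
  then have "e = 2 * \<i> * (Im e / 2)" by (simp add: quat_inner inner_complex_def complex_eq_iff)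
  then have "l = covec q (Im e / 2) (f / 2)" using ql by (simp add: covec_def)
  then show "l \<in> range (\<lambda>(a, z). covec q a z)" by (auto intro!: image_eqI[of _ _ "(Im e / 2, f / 2)"])
qed (auto simp: cotangent_space_SU2[OF q] covec_in_bundle[OF q])

text \<open>Here \<open>rot\<close> is right multiplication by \<open>quat (cis (- a)) 0\<close>. It
  multiplies the second entry by the conjugate phase, hence the opposite signs in
  \<open>expu\<close> and \<open>expw\<close>.\<close>

lemma sr_exp_covec:
  assumes q: "q \<in> SU2"
  shows "sr_exp q (covec q a z) = q ** quat (expu a z) (expw a z)"
proof -
  define r where "r = sqrt (a\<^sup>2 + (cmod z)\<^sup>2)"
  have "covec q a z \<bullet> covec q a z = 8 * (a\<^sup>2 + (cmod z)\<^sup>2)"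
    unfolding covec_def SU2_mult_inner[OF q quat_in_quats quat_in_quats]
    by (simp add: quat_inner inner_complex_def cmod_power2) (simp add: power2_eq_square)
  then have r: "sqrt (covec q a z \<bullet> covec q a z / 8) = r" by (simp add: r_def)
  have h: "covec q a z \<bullet> (q ** X0) = 2 * a"
    unfolding covec_def using SU2_mult_inner[OF q quat_in_quats X_in_quats(1)]
    by (simp add: inner_mat2 inner_complex_def)
  have rot: "rot \<theta> A = A ** quat (cis (- \<theta>)) 0" for \<theta> A
    by (simp add: rot_def mat2_eq_iff mult_mat2 complex_eq_iff algebra_simps)
  have "cos r *\<^sub>R q + (sinq r 1 / 2) *\<^sub>R covec q a z =
      q ** quat (cos r + \<i> * a * sinq r 1) (z * sinq r 1)"
    by (simp add: covec_def mat2_eq_iff mult_mat2 scaleR_conv_of_real[where 'a = complex] algebra_simps)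
  then have "sr_exp q (covec q a z) =
      q ** (quat (cos r + \<i> * a * sinq r 1) (z * sinq r 1) ** quat (cis (- a)) 0)"
    using sr_exp_eq[OF covec_in_bundle[OF q], of a z]
    by (simp add: r h rot matrix_mul_assoc)
  also have "quat (cos r + \<i> * a * sinq r 1) (z * sinq r 1) ** quat (cis (- a)) 0 = quat (expu a z) (expw a z)"
    by (simp add: quat_mult expu_def expw_def Let_def r_def cis_cnj)
  finally show ?thesis .
qed

lemma bounded_linear_mat_nth:
  "bounded_linear (\<lambda>A :: complex^2^2. A $ i $ j)"
  by (intro bounded_linear_compose[OF bounded_linear_vec_nth] bounded_linear_vec_nth)

lemma linear_covec: "linear (\<lambda>(a, z). covec q a z)"
  by (rule linearI) (auto simp: covec_def mat2_eq_iff mult_mat2 complex_eq_iff algebra_simps)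

theorem proposition19:
  fixes q l0 :: "complex^2^2" and U :: "(complex^2^2) set"
  assumes "q \<in> SU2"
    and "l0 \<in> conjugate_locus q"
    and "openin (top_of_set (cotangent_space SU2 q)) U" and "l0 \<in> U"
  shows "\<not> inj_on (sr_exp q) U"
proof
  assume inj: "inj_on (sr_exp q) U"
  note q = assms(1)
  note T = cotangent_space_SU2_eq_range[OF q]
  obtain p where p: "p ** q = mat 1" using SU2_inverse[OF q] by blast
  have cancel: "A = B" if "q ** A = q ** B" for A B :: "complex^2^2"
    using arg_cong[OF that, of "\<lambda>C. p ** C"] by (simp add: matrix_mul_assoc p)
  obtain D where D: "(sr_exp q has_derivative D) (at l0 within cotangent_space SU2 q)"
    and K: "{v \<in> cotangent_space SU2 q. D v = 0} \<noteq> {0}" and l0: "l0 \<in> cotangent_space SU2 q"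
    using assms(2) by (auto simp: conjugate_locus_def)
  have c0: "covec q 0 0 = 0" using linear_0[OF linear_covec[of q]] by (simp add: zero_prod_def)
  have D0: "D 0 = 0" using D by (simp add: has_derivative_bounded_linear bounded_linear.linear linear_0)
  have "0 \<in> cotangent_space SU2 q" unfolding T using c0 by (auto intro!: image_eqI[of _ _ "(0, 0)"])
  \<comment> \<open>The kernel contains 0, so being different from \<open>{0}\<close> means that it
    has a nonzero element.\<close>
  with K D0 obtain v where v: "v \<in> cotangent_space SU2 q" "D v = 0" "v \<noteq> 0" by blast
  obtain a z where az: "l0 = covec q a z" using l0 unfolding T by auto
  obtain \<alpha> \<zeta> where v': "v = covec q \<alpha> \<zeta>" using v(1) unfolding T by auto
  have ne: "(\<alpha>, \<zeta>) \<noteq> (0, 0)" using v(3) v' c0 by auto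
  have line: "covec q (a + t * \<alpha>) (z + of_real t * \<zeta>) = l0 + t *\<^sub>R v" for t
    by (simp add: az v' covec_def mat2_eq_iff mult_mat2 complex_eq_iff algebra_simps)
  have "((\<lambda>t. l0 + t *\<^sub>R v) has_vector_derivative v) (at 0)"
    by (auto intro!: derivative_eq_intros)
  \<comment> \<open>The line stays in the cotangent space, so the derivative within that space can
    be composed with it.\<close>
  moreover have "range (\<lambda>t. l0 + t *\<^sub>R v) \<subseteq> cotangent_space SU2 q"
    unfolding T line[symmetric] by auto
  ultimately have "((\<lambda>t. sr_exp q (l0 + t *\<^sub>R v)) has_vector_derivative 0) (at 0)"
    using diff_chain_within[of "\<lambda>t. l0 + t *\<^sub>R v" "\<lambda>t. t *\<^sub>R v" 0 UNIV "sr_exp q" D]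
      has_derivative_subset[OF D, of "range (\<lambda>t. l0 + t *\<^sub>R v)"] v(2)
      bounded_linear.linear[OF has_derivative_bounded_linear[OF D]]
    by (simp add: has_vector_derivative_def o_def linear_scale)
  \<comment> \<open>Multiplication by the inverse \<open>p\<close> of \<open>q\<close> removes the
    left translation, leaving \<open>expu\<close> and \<open>expw\<close> as first row.\<close>
  then have "((\<lambda>t. p ** sr_exp q (covec q (a + t * \<alpha>) (z + of_real t * \<zeta>))) has_vector_derivative p ** 0) (at 0)"
    unfolding line by (rule bounded_linear.has_vector_derivative[OF bounded_linear_matrix_mult_left])
  then have "((\<lambda>t. quat (expu (a + t * \<alpha>) (z + of_real t * \<zeta>)) (expw (a + t * \<alpha>) (z + of_real t * \<zeta>)))
      has_vector_derivative p ** 0) (at 0)" (is "(?f has_vector_derivative _) _")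
    unfolding sr_exp_covec[OF q] by (simp add: matrix_mul_assoc p)
  then have E: "((\<lambda>t. ?f t $ 1 $ j) has_vector_derivative (p ** 0) $ 1 $ j) (at 0)" for j
    by (rule bounded_linear.has_vector_derivative[OF bounded_linear_mat_nth])
  define V where "V = (\<lambda>(a, z). covec q a z) -` U"
  obtain W where W: "open W" "U = cotangent_space SU2 q \<inter> W"
    using assms(3) by (auto simp: openin_open)
  \<comment> \<open>As \<open>covec q\<close> only takes values in the cotangent space, relative
    openness of \<open>U\<close> becomes openness in the coordinates.\<close>
  have "V = (\<lambda>(a, z). covec q a z) -` W"
    unfolding V_def W(2) T by auto
  then have "open V"
    using W(1) linear_continuous_on[OF linear_conv_bounded_linear[THEN iffD1, OF linear_covec[of q]], of UNIV]
    by (simp add: open_vimage)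
  moreover have "(a, z) \<in> V" using assms(4) az by (simp add: V_def)
  ultimately have "\<not> inj_on (\<lambda>(a, z). (expu a z, expw a z)) V"
    by (rule critical_not_inj[OF _ _ ne]) (use E[of 1] E[of 2] in \<open>simp_all add: mult_mat2\<close>)
  then obtain b y b' y' where *: "(b, y) \<in> V" "(b', y') \<in> V" "(b, y) \<noteq> (b', y')"
      "expu b y = expu b' y'" "expw b y = expw b' y'"
    unfolding inj_on_def by auto
  have "covec q b y = covec q b' y'"
    by (rule inj_onD[OF inj]) (use * in \<open>auto simp: V_def sr_exp_covec[OF q]\<close>)
  then have "quat (2 * \<i> * b) (2 * y) = quat (2 * \<i> * b') (2 * y')"
    unfolding covec_def by (rule cancel)
  then show False using *(3) by (simp add: mat2_eq_iff)
qed

end
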